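(* Let $f(\mathcal{X})=\frac12\|\mathcal{A}(\mathcal{X})-\mathbf{y}\|^2$ with $\mathbf{y}\in\mathbb{R}^m$. Suppose the linear map $\mathcal{A}:\mathbb{R}^{n_1\times n_2\times n_3}\to\mathbb{R}^m$ satisfies the tensor-tubal-rank restricted isometry condition (tRIP) with restricted isometry constants $\delta_s$ (for $s=2r$ and $s=3r$), and the measurements satisfy $\mathbf{y}=\mathcal{A}(\mathcal{X}^* )+\mathbf{e}$ with $\mathrm{rank}_t(\mathcal{X}^* )\le r$ and $\|\mathbf{e}\|\le\varepsilon$. Let $\mathcal{X}^t$ denote the $t$-th iterate of the Iterative Singular Tube Hard Thresholding algorithm with tubal rank $r$ and step size $\gamma$, that is, $$\mathcal{X}^0=\mathbf{0},\qquad \mathcal{Z}^{t+1}=\mathcal{X}^t-\gamma\nabla f(\mathcal{X}^t),\qquad \mathcal{X}^{t+1}=\mathcal{H}_r(\mathcal{Z}^{t+1}),\qquad t=0,1,2,\ldots$$ Then the $t$-th iteration has the bounded recovery error $$\|\mathcal{X}^t-\mathcal{X}^*\|\le\kappa^t\|\mathcal{X}^0-\mathcal{X}^*\|+\frac{\sigma}{1-\kappa},$$ where $$\kappa=2\left(|1-\gamma|+\gamma\delta_{3r}\right),\qquad \sigma=2\gamma\varepsilon\sqrt{1+\delta_{2r}}.$$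
   Context: Tensor space: $\mathbb{R}^{n_1\times n_2\times n_3}$ carries the inner product $\langle\mathcal{X},\mathcal{Y}\rangle=\sum_{i,j,k}\mathcal{X}_{i,j,k}\mathcal{Y}_{i,j,k}$ and the Frobenius norm $\|\mathcal{X}\|=\sqrt{\langle\mathcal{X},\mathcal{X}\rangle}$; on $\mathbb{R}^m$, $\|\cdot\|$ is the Euclidean norm. $\nabla f(\mathcal{X})$ is the tensor of partial derivatives $\partial f/\partial\mathcal{X}_{i,j,k}$. t-product: for $\mathcal{B}\in\mathbb{R}^{n_1\times n_2\times n_3}$ and $\mathcal{C}\in\mathbb{R}^{n_2\times n_4\times n_3}$, $\mathcal{B}*\mathcal{C}\in\mathbb{R}^{n_1\times n_4\times n_3}$ is given by $(\mathcal{B}*\mathcal{C})(i,j,:)=\sum_{k=1}^{n_2}\mathcal{B}(i,k,:)\odot\mathcal{C}(k,j,:)$, where $\odot$ is circular convolution of vectors of length $n_3$. The transpose $\mathcal{X}^T$ is obtained by transposing each frontal slice $\mathcal{X}(:,:,k)$ and then reversing the order of the transposed slices $2$ through $n_3$. The identity tensor $\mathcal{I}$ has the identity matrix as first frontal slice and zero matrices as the others. A tensor $\mathcal{Q}$ is orthogonal if $\mathcal{Q}*\mathcal{Q}^T=\mathcal{Q}^T*\mathcal{Q}=\mathcal{I}$. A tensor is f-diagonal if all its frontal slices are diagonal matrices. t-SVD and tubal rank: every $\mathcal{X}\in\mathbb{R}^{n_1\times n_2\times n_3}$ can be written $\mathcal{X}=\mathcal{U}*\mathcal{S}*\mathcal{V}^T$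 with $\mathcal{U}\in\mathbb{R}^{n_1\times n_1\times n_3}$, $\mathcal{V}\in\mathbb{R}^{n_2\times n_2\times n_3}$ orthogonal and $\mathcal{S}\in\mathbb{R}^{n_1\times n_2\times n_3}$ f-diagonal; it is computed by taking the discrete Fourier transform along the third dimension, taking an SVD (singular values in nonincreasing order) of each frontal slice, and transforming back. The tubal rank $\mathrm{rank}_t(\mathcal{X})$ is the number of nonzero tubes $\mathcal{S}(i,i,:)$ of $\mathcal{S}$. Singular tube hard thresholding: for $r\le\min\{n_1,n_2\}$, $\mathcal{H}_r(\mathcal{X})=\mathcal{U}*\mathcal{H}_r(\mathcal{S})*\mathcal{V}^T$, where $\mathcal{H}_r(\mathcal{S})$ is obtained from $\mathcal{S}$ by setting the tubes $\mathcal{S}(i,i,:)$ with $i>r$ to zero. $\mathcal{H}_r(\mathcal{X})$ is a best approximation of $\mathcal{X}$ in Frobenius norm among tensors of tubal rank at most $r$. tRIP: a linear map $\boldsymbol\theta:\mathbb{R}^{n_1\times n_2\times n_3}\to\mathbb{R}^m$ satisfies the tensor-tubal-rank $s$ restricted isometry condition with restricted isometry constant $\delta_s\in(0,1)$ if $(1-\delta_s)\|\mathcal{X}\|^2\le\|\boldsymbol\theta(\mathcal{X})\|^2\le(1+\delta_s)\|\mathcal{X}\|^2$ for every tensor $\mathcal{X}$ of tubal rank at most $s$.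
   Formalization: The formal statement adds the hypothesis κ < 1, implicit in the term σ/(1−κ); without it the bound is undefined at κ = 1 and false for κ > 1 with positive noise level (e.g. X* = 0, e = 0, ε > 0, γ = 2, t = 0). *)

theory Defs
  imports "HOL-Analysis.Analysis"
begin

text \<open>
  A real third-order tensor of size n1 x n2 x n3 is a function on triples of natural numbers
  vanishing outside the index box. Indices start at 0, so the first frontal slice has index 0.
\<close>

type_synonym tensor = "nat \<Rightarrow> nat \<Rightarrow> nat \<Rightarrow> real"

definition tensors :: "nat \<Rightarrow> nat \<Rightarrow> nat \<Rightarrow> tensor set" where
  "tensors n1 n2 n3 = {X. \<forall>i j k. \<not> (i < n1 \<and> j < n2 \<and> k < n3) \<longrightarrow> X i j k = 0}"

definition tinner :: "nat \<Rightarrow> nat \<Rightarrow> nat \<Rightarrow> tensor \<Rightarrow> tensor \<Rightarrow> real" where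
  "tinner n1 n2 n3 X Y = (\<Sum>i<n1. \<Sum>j<n2. \<Sum>k<n3. X i j k * Y i j k)"

definition tnorm :: "nat \<Rightarrow> nat \<Rightarrow> nat \<Rightarrow> tensor \<Rightarrow> real" where
  "tnorm n1 n2 n3 X = sqrt (tinner n1 n2 n3 X X)"

definition tlinear :: "nat \<Rightarrow> nat \<Rightarrow> nat \<Rightarrow> (tensor \<Rightarrow> 'b::real_vector) \<Rightarrow> bool" where
  "tlinear n1 n2 n3 A \<longleftrightarrow>
     (\<forall>X\<in>tensors n1 n2 n3. \<forall>Y\<in>tensors n1 n2 n3. A (\<lambda>i j k. X i j k + Y i j k) = A X + A Y) \<and>
     (\<forall>c. \<forall>X\<in>tensors n1 n2 n3. A (\<lambda>i j k. c * X i j k) = c *\<^sub>R A X)"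

text \<open>The entries of the gradient are the partial derivatives in the single entry (i, j, k).\<close>

definition tgrad :: "nat \<Rightarrow> nat \<Rightarrow> nat \<Rightarrow> (tensor \<Rightarrow> real) \<Rightarrow> tensor \<Rightarrow> tensor" where
  "tgrad n1 n2 n3 f X = (\<lambda>i j k.
     if i < n1 \<and> j < n2 \<and> k < n3
     then deriv (\<lambda>h. f (X(i := (X i)(j := (X i j)(k := h))))) (X i j k)
     else 0)"

definition circ_conv :: "nat \<Rightarrow> (nat \<Rightarrow> real) \<Rightarrow> (nat \<Rightarrow> real) \<Rightarrow> nat \<Rightarrow> real" where
  "circ_conv n a b k = (if k < n then \<Sum>l<n. a l * b ((k + n - l) mod n) else 0)"

text \<open>In the t-product, n2 is the shared inner dimension and n3 the tube length.\<close>

definition tprod :: "nat \<Rightarrow> nat \<Rightarrow> tensor \<Rightarrow> tensor \<Rightarrow> tensor" where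
  "tprod n2 n3 B C = (\<lambda>i j k. \<Sum>p<n2. circ_conv n3 (B i p) (C p j) k)"

definition ttranspose :: "nat \<Rightarrow> tensor \<Rightarrow> tensor" where
  "ttranspose n3 X = (\<lambda>i j k.
     if k < n3 then X j i (if k = 0 then 0 else n3 - k) else 0)"

definition tident :: "nat \<Rightarrow> nat \<Rightarrow> tensor" where
  "tident n n3 = (\<lambda>i j k. if i < n \<and> j = i \<and> k = 0 \<and> k < n3 then 1 else 0)"

definition torthogonal :: "nat \<Rightarrow> nat \<Rightarrow> tensor \<Rightarrow> bool" where
  "torthogonal n n3 Q \<longleftrightarrow> Q \<in> tensors n n n3 \<and>
     tprod n n3 Q (ttranspose n3 Q) = tident n n3 \<and>
     tprod n n3 (ttranspose n3 Q) Q = tident n n3"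

definition f_diagonal :: "tensor \<Rightarrow> bool" where
  "f_diagonal S \<longleftrightarrow> (\<forall>i j k. i \<noteq> j \<longrightarrow> S i j k = 0)"

definition dft3 :: "nat \<Rightarrow> tensor \<Rightarrow> nat \<Rightarrow> nat \<Rightarrow> nat \<Rightarrow> complex" where
  "dft3 n3 X i j k =
     (\<Sum>l<n3. complex_of_real (X i j l) * cis (- 2 * pi * real k * real l / real n3))"

text \<open>
  The t-SVD comes from an SVD of each frontal slice of the discrete Fourier transform along the
  third dimension. The transform turns the t-product into slicewise matrix products, the tensor
  transpose into conjugate transposes and orthogonal tensors into unitary slices. What remains to
  be required is that each transformed slice of S carries singular values, that is, real
  nonnegative diagonal entries in nonincreasing order. Without this ordering, the number of nonzero
  tubes of S would depend on the factorization.
\<close>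

definition is_tsvd ::
  "nat \<Rightarrow> nat \<Rightarrow> nat \<Rightarrow> tensor \<Rightarrow> tensor \<Rightarrow> tensor \<Rightarrow> tensor \<Rightarrow> bool" where
  "is_tsvd n1 n2 n3 X U S V \<longleftrightarrow>
     torthogonal n1 n3 U \<and> torthogonal n2 n3 V \<and>
     S \<in> tensors n1 n2 n3 \<and> f_diagonal S \<and>
     X = tprod n2 n3 (tprod n1 n3 U S) (ttranspose n3 V) \<and>
     (\<forall>k<n3. \<forall>i<min n1 n2. Im (dft3 n3 S i i k) = 0 \<and> 0 \<le> Re (dft3 n3 S i i k)) \<and>
     (\<forall>k<n3. \<forall>i j. i \<le> j \<and> j < min n1 n2 \<longrightarrow> Re (dft3 n3 S j j k) \<le> Re (dft3 n3 S i i k))"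

text \<open>The middle factor S is determined by X, so the choice below is immaterial.\<close>

definition tubal_rank :: "nat \<Rightarrow> nat \<Rightarrow> nat \<Rightarrow> tensor \<Rightarrow> nat" where
  "tubal_rank n1 n2 n3 X =
     (let S = (SOME S. \<exists>U V. is_tsvd n1 n2 n3 X U S V)
      in card {i. i < min n1 n2 \<and> (\<exists>k<n3. S i i k \<noteq> 0)})"

definition truncate_tubes :: "nat \<Rightarrow> tensor \<Rightarrow> tensor" where
  "truncate_tubes r S = (\<lambda>i j k. if i = j \<and> r \<le> i then 0 else S i j k)"

text \<open>
  The factors U and V are not unique, and the thresholded tensor may depend on them when singular
  values coincide. Hard thresholding is therefore the set of results over all t-SVDs of X.
\<close>

definition tube_hard_thresholds :: "nat \<Rightarrow> nat \<Rightarrow> nat \<Rightarrow> nat \<Rightarrow> tensor \<Rightarrow> tensor set" where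
  "tube_hard_thresholds n1 n2 n3 r X =
     {tprod n2 n3 (tprod n1 n3 U (truncate_tubes r S)) (ttranspose n3 V) | U S V.
        is_tsvd n1 n2 n3 X U S V}"

definition tRIP ::
  "nat \<Rightarrow> nat \<Rightarrow> nat \<Rightarrow> (tensor \<Rightarrow> 'b::real_normed_vector) \<Rightarrow> nat \<Rightarrow> real \<Rightarrow> bool" where
  "tRIP n1 n2 n3 A s \<delta> \<longleftrightarrow> 0 < \<delta> \<and> \<delta> < 1 \<and>
     (\<forall>X\<in>tensors n1 n2 n3. tubal_rank n1 n2 n3 X \<le> s \<longrightarrow>
        (1 - \<delta>) * (tnorm n1 n2 n3 X)\<^sup>2 \<le> (norm (A X))\<^sup>2 \<and>
        (norm (A X))\<^sup>2 \<le> (1 + \<delta>) * (tnorm n1 n2 n3 X)\<^sup>2)"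

end

theory Submission
  imports Defs
begin

text \<open>
  Hard thresholding is a best approximation of tubal rank at most \<open>r\<close> (slicewise Eckart--Young in
  the Fourier domain plus Parseval), so with \<open>d' = X' - X\<^sup>*\<close>, \<open>d = X - X\<^sup>*\<close> and
  \<open>Z = X - \<gamma> \<nabla>f(X)\<close> one gets
  \<open>\<parallel>d'\<parallel>\<^sup>2 \<le> 2 \<langle>d', Z - X\<^sup>*\<rangle> = 2 (\<langle>d', d\<rangle> - \<gamma> \<langle>A d', A d\<rangle>) + 2 \<gamma> \<langle>A d', e\<rangle>\<close>.
  All combinations of \<open>d'\<close> and \<open>d\<close> have tubal rank at most \<open>3 r\<close>, so polarising the quadratic form
  \<open>\<parallel>w\<parallel>\<^sup>2 - \<gamma> \<parallel>A w\<parallel>\<^sup>2\<close>, which tRIP bounds by \<open>(\<bar>1 - \<gamma>\<bar> + \<gamma> \<delta>\<^sub>3\<^sub>r) \<parallel>w\<parallel>\<^sup>2\<close>, controls the first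
  term, and the second is at most
  \<open>2 \<gamma> \<epsilon> \<surd>(1 + \<delta>\<^sub>2\<^sub>r) \<parallel>d'\<parallel>\<close>. The tubal rank is the largest rank of a Fourier slice; since it is
  defined by choosing some t-SVD, its subadditivity needs that every tensor has one.
\<close>

section \<open>Complex matrices and the Eckart--Young theorem\<close>

text \<open>The factor 2 in \<open>\<kappa>\<close> appears because the tensors of bounded tubal
  rank do not form a convex set: comparing two distances to \<open>Z\<close> and expanding the
  square bounds the squared error only by twice an inner product. The noise term tests
  \<open>A\<close> on a difference of two tensors of rank \<open>r\<close>. The cross term tests it
  on combinations of two differences that share \<open>Xstar\<close>, hence on three such tensors.

  Rank is handled through two predicates on Fourier slices that mention no chosen t-SVD. A
  factorization through \<open>s\<close> dimensions is additive under sums and bounds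
  \<open>tubal_rank\<close> from above. A factorization with a unitary left factor is the shape in
  which competitors enter Eckart--Young. A bound on \<open>tubal_rank\<close> yields the second, and
  for \<open>r \<le> n1\<close> the second yields the first.

  Slicewise SVDs come from a variational construction that runs in the same way over the reals and
  the complex numbers. The sign of \<open>\<gamma>\<close>, on which the polarised estimate rests,
  is extracted from \<open>\<kappa> < 1\<close>.\<close>

type_synonym cmat = "nat \<Rightarrow> nat \<Rightarrow> complex"

text \<open>Matrices carry no dimensions: the parameter is only the inner one, so associativity
  holds without hypotheses. \<open>supp\<close> enters where an equality of total functions depends
  on entries outside the box, as in multiplication by \<open>idm\<close>.\<close>

definition mmul :: "nat \<Rightarrow> cmat \<Rightarrow> cmat \<Rightarrow> cmat" where
  "mmul n A B = (\<lambda>i j. \<Sum>p<n. A i p * B p j)"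

definition adj :: "cmat \<Rightarrow> cmat" where
  "adj A = (\<lambda>i j. cnj (A j i))"

definition idm :: "nat \<Rightarrow> cmat" where
  "idm n = (\<lambda>i j. if i < n \<and> j = i then 1 else 0)"

definition supp :: "nat \<Rightarrow> nat \<Rightarrow> cmat \<Rightarrow> bool" where
  "supp n m A \<longleftrightarrow> (\<forall>i j. \<not> (i < n \<and> j < m) \<longrightarrow> A i j = 0)"

definition fro :: "nat \<Rightarrow> nat \<Rightarrow> cmat \<Rightarrow> real" where
  "fro n m A = (\<Sum>i<n. \<Sum>j<m. (cmod (A i j))\<^sup>2)"

definition unitary :: "nat \<Rightarrow> cmat \<Rightarrow> bool" where
  "unitary n U \<longleftrightarrow> supp n n U \<and> mmul n U (adj U) = idm n \<and> mmul n (adj U) U = idm n"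

lemma mmul_assoc: "mmul n (mmul m A B) C = mmul m A (mmul n B C)"
proof (intro ext)
  fix i j
  have "mmul n (mmul m A B) C i j = (\<Sum>q<n. \<Sum>p<m. A i p * B p q * C q j)"
    by (simp add: mmul_def sum_distrib_right)
  also have "\<dots> = (\<Sum>p<m. \<Sum>q<n. A i p * B p q * C q j)"
    by (rule sum.swap)
  also have "\<dots> = mmul m A (mmul n B C) i j"
    by (simp add: mmul_def sum_distrib_left mult.assoc)
  finally show "mmul n (mmul m A B) C i j = mmul m A (mmul n B C) i j" .
qed

lemma adj_mmul: "adj (mmul n A B) = mmul n (adj B) (adj A)"
  by (simp add: adj_def mmul_def fun_eq_iff mult.commute)

lemma adj_adj [simp]: "adj (adj A) = A"
  by (simp add: adj_def)

lemma supp_adj: "supp n m A \<Longrightarrow> supp m n (adj A)"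
  by (auto simp: supp_def adj_def)

lemma supp_mmul:
  assumes "supp n k A" "supp k' m B"
  shows "supp n m (mmul l A B)"
  using assms unfolding supp_def mmul_def by (metis (no_types, lifting) mult_eq_0_iff sum.neutral)

lemma sum_idm:
  "i < n \<Longrightarrow> (\<Sum>p<n. idm n i p * f p) = f i"
  "i < n \<Longrightarrow> (\<Sum>p<n. f p * idm n p i) = f i"
proof -
  assume i: "i < n"
  have "(\<Sum>p<n. idm n i p * f p) = (\<Sum>p<n. if p = i then f p else 0)"
    using i by (intro sum.cong) (auto simp: idm_def)
  then show "(\<Sum>p<n. idm n i p * f p) = f i" using i by simp
  have "(\<Sum>p<n. f p * idm n p i) = (\<Sum>p<n. if p = i then f p else 0)"
    using i by (intro sum.cong) (auto simp: idm_def)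
  then show "(\<Sum>p<n. f p * idm n p i) = f i" using i by simp
qed

lemma mmul_idm_left: "supp n m A \<Longrightarrow> mmul n (idm n) A = A"
proof (intro ext)
  fix i j assume A: "supp n m A"
  show "mmul n (idm n) A i j = A i j"
  proof (cases "i < n")
    case True then show ?thesis by (simp add: mmul_def sum_idm)
  next
    case False then show ?thesis using A by (simp add: mmul_def idm_def supp_def)
  qed
qed

lemma mmul_idm_right: "supp n m A \<Longrightarrow> mmul m A (idm m) = A"
proof (intro ext)
  fix i j assume A: "supp n m A"
  show "mmul m A (idm m) i j = A i j"
  proof (cases "j < m")
    case True then show ?thesis by (simp add: mmul_def sum_idm)
  next
    case False
    then have "\<And>p. p < m \<Longrightarrow> idm m p j = 0" by (auto simp: idm_def)
    then show ?thesis using A False by (simp add: mmul_def supp_def)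
  qed
qed

text \<open>Between two factors the row index of \<open>idm\<close> is summed only below
  \<open>n\<close>, so no support condition arises.\<close>

lemma mmul_idm_mid: "mmul n A (mmul n (idm n) B) = mmul n A B"
  by (intro ext) (simp add: mmul_def sum_idm)

lemma mmul_diff_left: "mmul n (\<lambda>i j. A i j - B i j) C = (\<lambda>i j. mmul n A C i j - mmul n B C i j)"
  by (simp add: mmul_def fun_eq_iff left_diff_distrib sum_subtractf)

lemma mmul_diff_right: "mmul n C (\<lambda>i j. A i j - B i j) = (\<lambda>i j. mmul n C A i j - mmul n C B i j)"
  by (simp add: mmul_def fun_eq_iff right_diff_distrib sum_subtractf)

lemma unitary_adj: "unitary n U \<Longrightarrow> unitary n (adj U)"
  by (simp add: unitary_def supp_adj)

lemma unitary_mmul: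
  assumes U: "unitary n U" and V: "unitary n V"
  shows "unitary n (mmul n U V)"
proof -
  have 1: "mmul n (mmul n U V) (mmul n (adj V) (adj U)) = mmul n U (mmul n (mmul n V (adj V)) (adj U))"
    by (simp add: mmul_assoc)
  have 2: "mmul n (mmul n (adj V) (adj U)) (mmul n U V) = mmul n (adj V) (mmul n (mmul n (adj U) U) V)"
    by (simp add: mmul_assoc)
  have "supp n n (mmul n U V)" using U V unfolding unitary_def by (blast intro: supp_mmul)
  then show ?thesis
    using U V 1 2 unfolding unitary_def by (simp add: adj_mmul mmul_idm_mid)
qed

lemma fro_eq_trace: "complex_of_real (fro n m A) = (\<Sum>j<m. mmul n (adj A) A j j)"
proof -
  have "fro n m A = (\<Sum>j<m. \<Sum>i<n. (cmod (A i j))\<^sup>2)"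
    unfolding fro_def by (rule sum.swap)
  then show ?thesis
    by (simp add: mmul_def adj_def complex_norm_square mult.commute flip: of_real_power)
qed

lemma fro_adj: "fro m n (adj A) = fro n m A"
  unfolding fro_def adj_def complex_mod_cnj by (rule sum.swap)

lemma fro_isometry:
  assumes "mmul n (adj U) U = idm n"
  shows "fro n m (mmul n U A) = fro n m A"
proof -
  have "mmul n (adj (mmul n U A)) (mmul n U A) = mmul n (adj A) (mmul n (mmul n (adj U) U) A)"
    by (simp add: adj_mmul mmul_assoc)
  also have "\<dots> = mmul n (adj A) A"
    by (simp add: assms mmul_idm_mid)
  finally have "complex_of_real (fro n m (mmul n U A)) = complex_of_real (fro n m A)"
    by (simp add: fro_eq_trace)
  then show ?thesis using of_real_eq_iff by blast
qed

lemma fro_isometry_right: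
  assumes "mmul m V (adj V) = idm m"
  shows "fro n m (mmul m A V) = fro n m A"
  using fro_isometry[of m "adj V" n "adj A"] assms
  by (metis adj_adj adj_mmul fro_adj)

lemma fro_idm: "fro n n (idm n) = real n"
proof -
  have "(\<Sum>j<n. (cmod (idm n i j))\<^sup>2) = 1" if "i < n" for i
  proof -
    have "(\<Sum>j<n. (cmod (idm n i j))\<^sup>2) = (\<Sum>j<n. if j = i then 1 else 0)"
      using that by (intro sum.cong) (auto simp: idm_def)
    then show ?thesis using that by simp
  qed
  then show ?thesis by (simp add: fro_def)
qed

lemma fro_eq_0:
  assumes "supp n m A" "fro n m A = 0"
  shows "A = (\<lambda>i j. 0)"
proof (intro ext)
  fix i j
  show "A i j = 0"
  proof (cases "i < n \<and> j < m")
    case True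
    have "(\<Sum>j<m. (cmod (A i j))\<^sup>2) = 0"
      using assms(2) True unfolding fro_def by (subst (asm) sum_nonneg_eq_0_iff) (auto intro: sum_nonneg)
    then show ?thesis
      using True by (subst (asm) sum_nonneg_eq_0_iff) auto
  next
    case False then show ?thesis using assms(1) by (auto simp: supp_def)
  qed
qed

text \<open>With \<open>P = U U\<^sup>*\<close> one has \<open>\<parallel>I - P\<parallel>\<^sup>2 = n - 2 tr P + \<parallel>P\<parallel>\<^sup>2\<close>, and both \<open>tr P\<close> and
  \<open>\<parallel>P\<parallel>\<^sup>2\<close> equal \<open>\<parallel>U\<parallel>\<^sup>2 = n\<close>.\<close>

lemma unitaryI:
  assumes s: "supp n n U" and U: "mmul n (adj U) U = idm n"
  shows "unitary n U"
proof -
  define P where "P = mmul n U (adj U)"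
  have frU: "fro n n U = real n"
  proof -
    have "complex_of_real (fro n n U) = (\<Sum>j<n. idm n j j)" by (simp add: fro_eq_trace U)
    also have "\<dots> = of_nat n" by (simp add: idm_def)
    finally show ?thesis by (metis of_real_eq_iff of_real_of_nat_eq)
  qed
  have frP: "fro n n P = real n"
    unfolding P_def by (simp add: fro_isometry[OF U] fro_adj frU)
  have trP: "(\<Sum>i<n. Re (P i i)) = real n"
  proof -
    have "complex_of_real (fro n n (adj U)) = (\<Sum>i<n. P i i)" by (simp add: fro_eq_trace P_def)
    then have "Re (complex_of_real (fro n n (adj U))) = (\<Sum>i<n. Re (P i i))" by simp
    then show ?thesis by (simp add: fro_adj frU)
  qed
  have e: "(cmod (idm n i j - P i j))\<^sup>2 = (cmod (idm n i j))\<^sup>2 + (cmod (P i j))\<^sup>2 - (if j = i then 2 * Re (P i j) else 0)"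
    if "i < n" for i j
    using that unfolding idm_def cmod_power2 by (auto simp: power2_eq_square algebra_simps)
  have "fro n n (\<lambda>i j. idm n i j - P i j) = fro n n (idm n) + fro n n P - 2 * (\<Sum>i<n. Re (P i i))"
    by (simp add: fro_def e sum.distrib sum_subtractf sum_distrib_left cong: sum.cong_simp)
  also have "\<dots> = 0" by (simp add: fro_idm frP trP)
  finally have "fro n n (\<lambda>i j. idm n i j - P i j) = 0" .
  moreover have "supp n n (\<lambda>i j. idm n i j - P i j)"
    using supp_mmul[OF s supp_adj[OF s], of n] by (auto simp: supp_def idm_def P_def)
  ultimately have "(\<lambda>i j. idm n i j - P i j) = (\<lambda>i j. 0)" by (intro fro_eq_0)
  then have "P = idm n" by (simp add: fun_eq_iff)
  then show ?thesis using s U by (simp add: unitary_def P_def)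
qed

text \<open>Gaussian elimination on the last equation. Only field operations occur, so coefficients
  in \<open>K\<close> give a solution in \<open>K\<close>; the real case later keeps singular
  vectors real.\<close>

lemma homogeneous_system_nontrivial:
  fixes a :: "nat \<Rightarrow> 'b \<Rightarrow> complex"
  assumes K: "K = \<real> \<or> K = UNIV"
    and "finite J" "m < card J" "\<And>i j. a i j \<in> K"
  shows "\<exists>x. (\<forall>j. x j \<in> K) \<and> (\<exists>j\<in>J. x j \<noteq> 0) \<and> (\<forall>i<m. (\<Sum>j\<in>J. a i j * x j) = 0)"
  using assms(2-)
proof (induction m arbitrary: J a)
  case 0
  then obtain j where "j \<in> J" by (metis card_gt_0_iff ex_in_conv)
  then show ?case using K by (intro exI[of _ "\<lambda>_. 1"]) auto
next
  case (Suc m)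
  show ?case
  proof (cases "\<exists>p\<in>J. a m p \<noteq> 0")
    case False
    then show ?thesis using Suc.IH[of J a] Suc.prems by (force simp: less_Suc_eq)
  next
    case True
    then obtain p where p: "p \<in> J" "a m p \<noteq> 0" by blast
    define J' where "J' = J - {p}"
    \<comment> \<open>Row operation: subtracting a multiple of equation \<open>m\<close> clears the
      unknown \<open>p\<close>. Below, \<open>s\<close> is the value of that unknown by back
      substitution.\<close>
    define b where "b = (\<lambda>i j. a i j - a i p * a m j / a m p)"
    have J: "J = insert p J'" "p \<notin> J'" "finite J'" using p Suc.prems by (auto simp: J'_def)
    have "m < card J'" using Suc.prems J by simp
    moreover have "b i j \<in> K" for i j
      using K Suc.prems(3) unfolding b_def by (elim disjE) auto
    ultimately obtain x where x: "\<And>j. x j \<in> K" "\<exists>j\<in>J'. x j \<noteq> 0"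
      "\<And>i. i < m \<Longrightarrow> (\<Sum>j\<in>J'. b i j * x j) = 0"
      using Suc.IH[of J' b] J(3) by blast
    define s where "s = - (\<Sum>j\<in>J'. a m j * x j) / a m p"
    have sK: "s \<in> K"
      using K x(1) Suc.prems(3) unfolding s_def by (elim disjE) (auto intro!: Reals_divide sum_in_Reals)
    define x' where "x' = x(p := s)"
    have eq: "(\<Sum>j\<in>J. a i j * x' j) = a i p * s + (\<Sum>j\<in>J'. a i j * x j)" for i
    proof -
      have "(\<Sum>j\<in>J'. a i j * x' j) = (\<Sum>j\<in>J'. a i j * x j)"
        using J(2) by (intro sum.cong) (auto simp: x'_def)
      then show ?thesis using J by (simp add: x'_def)
    qed
    have "(\<Sum>j\<in>J. a i j * x' j) = 0" if "i < Suc m" for i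
    proof (cases "i = m")
      case True
      then show ?thesis using p(2) by (simp add: eq s_def)
    next
      case False
      then have "(\<Sum>j\<in>J'. b i j * x j) = 0" using that x(3) by simp
      then have "(\<Sum>j\<in>J'. a i j * x j) = a i p / a m p * (\<Sum>j\<in>J'. a m j * x j)"
        by (simp add: b_def left_diff_distrib sum_subtractf sum_distrib_left mult.assoc)
      then show ?thesis by (simp add: eq s_def)
    qed
    moreover have "\<exists>j\<in>J. x' j \<noteq> 0" using x(2) J by (auto simp: x'_def)
    moreover have "x' j \<in> K" for j using x(1) sK by (simp add: x'_def)
    ultimately show ?thesis by blast
  qed
qed

section \<open>Singular values, rank and best approximation\<close>

definition is_svd :: "nat \<Rightarrow> nat \<Rightarrow> cmat \<Rightarrow> cmat \<Rightarrow> cmat \<Rightarrow> cmat \<Rightarrow> bool" where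
  "is_svd n1 n2 M U S V \<longleftrightarrow>
     unitary n1 U \<and> unitary n2 V \<and> supp n1 n2 S \<and> (\<forall>i j. i \<noteq> j \<longrightarrow> S i j = 0) \<and>
     M = mmul n2 (mmul n1 U S) (adj V) \<and>
     (\<forall>i<min n1 n2. Im (S i i) = 0 \<and> 0 \<le> Re (S i i)) \<and>
     (\<forall>i j. i \<le> j \<and> j < min n1 n2 \<longrightarrow> Re (S j j) \<le> Re (S i i))"

lemma is_svd_middle:
  assumes "is_svd n1 n2 M U S V"
  shows "S = mmul n1 (adj U) (mmul n2 M V)"
proof -
  have U: "unitary n1 U" and V: "unitary n2 V" and S: "supp n1 n2 S"
    and M: "M = mmul n2 (mmul n1 U S) (adj V)"
    using assms by (auto simp: is_svd_def)
  have "mmul n1 (adj U) (mmul n2 M V) = mmul n1 (mmul n1 (adj U) U) (mmul n2 S (mmul n2 (adj V) V))"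
    by (simp add: M mmul_assoc)
  also have "\<dots> = S"
    using U V S by (simp add: unitary_def mmul_idm_right[OF S] mmul_idm_left[OF S])
  finally show ?thesis by simp
qed

text \<open>Otherwise the ordering makes the first \<open>i + 1\<close> diagonal entries of
  \<open>S\<close> nonzero, so \<open>S\<close> is injective on the first \<open>i + 1\<close>
  coordinates, although it factors through only \<open>s\<close> dimensions.\<close>

lemma svd_rank_bound:
  assumes svd: "is_svd n1 n2 M U S V" and M: "M = mmul s A B"
    and i: "s \<le> i" "i < min n1 n2"
  shows "S i i = 0"
proof (rule ccontr)
  assume nz: "S i i \<noteq> 0"
  have diag: "S p q = 0" if "p \<noteq> q" for p q using svd that by (auto simp: is_svd_def)
  have pos: "S p p \<noteq> 0" if "p \<le> i" for p
  proof -
    have "Im (S i i) = 0" "0 \<le> Re (S i i)" using svd i(2) by (auto simp: is_svd_def)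
    then have "0 < Re (S i i)" using nz by (metis complex_eq_iff less_eq_real_def zero_complex.simps)
    also have "Re (S i i) \<le> Re (S p p)" using svd i(2) that by (auto simp: is_svd_def)
    finally show ?thesis by auto
  qed
  define A' where "A' = mmul n1 (adj U) A"
  define B' where "B' = mmul n2 B V"
  have S: "S = mmul s A' B'"
    using is_svd_middle[OF svd] by (simp add: M A'_def B'_def mmul_assoc)
  \<comment> \<open>A vector on \<open>i + 1\<close> coordinates killed by the \<open>s\<close> rows
    of \<open>B'\<close>; it exists because \<open>s \<le> i\<close>.\<close>
  obtain x where x: "\<exists>j\<in>{..i}. x j \<noteq> 0" "\<forall>p<s. (\<Sum>j\<le>i. B' p j * x j) = 0"
    using homogeneous_system_nontrivial[of UNIV "{..i}" s B'] i by auto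
  then obtain j where j: "j \<le> i" "x j \<noteq> 0" by auto
  have "(\<Sum>q\<le>i. S j q * x q) = (\<Sum>q\<le>i. \<Sum>p<s. A' j p * (B' p q * x q))"
    by (simp add: S mmul_def sum_distrib_right mult.assoc)
  also have "\<dots> = (\<Sum>p<s. \<Sum>q\<le>i. A' j p * (B' p q * x q))" by (rule sum.swap)
  also have "\<dots> = 0" using x(2) by (simp flip: sum_distrib_left)
  finally have "(\<Sum>q\<le>i. S j q * x q) = 0" .
  moreover have "(\<Sum>q\<le>i. S j q * x q) = (\<Sum>q\<le>i. if q = j then S j j * x j else 0)"
    by (intro sum.cong) (auto simp: diag)
  ultimately have "S j j * x j = 0" using j by simp
  then show False using pos[OF j(1)] j(2) by simp
qed

lemma mmul_restrict_rows:
  assumes "r \<le> n" "\<And>p j. r \<le> p \<Longrightarrow> B p j = 0"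
  shows "mmul n A B = mmul r A B"
proof (intro ext)
  fix i j
  show "mmul n A B i j = mmul r A B i j"
    unfolding mmul_def using assms by (intro sum.mono_neutral_right) auto
qed

text \<open>Block factorization with \<open>[A C]\<close> on the left and \<open>B\<close> stacked
  over \<open>D\<close> on the right; it is the source of subadditivity of rank.\<close>

lemma mmul_add_factors:
  "(\<lambda>i j. mmul s A B i j + mmul t C D i j) =
     mmul (s + t) (\<lambda>i p. if p < s then A i p else C i (p - s)) (\<lambda>p j. if p < s then B p j else D (p - s) j)"
proof (intro ext)
  fix i j
  let ?f = "\<lambda>p. (if p < s then A i p else C i (p - s)) * (if p < s then B p j else D (p - s) j)"
  have "{..<s + t} = {..<s} \<union> {s..<s + t}" by auto
  then have "(\<Sum>p<s+t. ?f p) = (\<Sum>p<s. ?f p) + (\<Sum>p\<in>{s..<s + t}. ?f p)"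
    by (simp add: sum.union_disjoint ivl_disj_int)
  also have "(\<Sum>p\<in>{s..<s + t}. ?f p) = (\<Sum>p<t. C i p * D p j)"
    by (intro sum.reindex_bij_witness[of _ "\<lambda>p. p + s" "\<lambda>p. p - s"]) auto
  finally show "mmul s A B i j + mmul t C D i j = mmul (s + t) (\<lambda>i p. if p < s then A i p else C i (p - s)) (\<lambda>p j. if p < s then B p j else D (p - s) j) i j"
    by (simp add: mmul_def)
qed

text \<open>With total weight \<open>n - r\<close> and at most 1 per entry, full weight on the
  smallest entries is cheapest. The value \<open>a r\<close> acts as a price: weight in the head
  costs at least that much, weight missing from the tail saves at most that much, and the two
  amounts agree.\<close>

lemma weighted_sum_ge_tail:
  fixes a w :: "nat \<Rightarrow> real"
  assumes r: "r \<le> n" and a: "\<And>i j. i \<le> j \<Longrightarrow> j < n \<Longrightarrow> a j \<le> a i"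
    and w: "\<And>j. j < n \<Longrightarrow> 0 \<le> w j" "\<And>j. j < n \<Longrightarrow> w j \<le> 1" "(\<Sum>j<n. w j) = real (n - r)"
  shows "(\<Sum>j\<in>{r..<n}. a j) \<le> (\<Sum>j<n. a j * w j)"
proof (cases "r = n")
  case True
  then have "(\<Sum>j<n. w j) = 0" using w by simp
  then have "\<forall>j<n. w j = 0" using w(1) by (subst (asm) sum_nonneg_eq_0_iff) auto
  then show ?thesis using True by simp
next
  case False
  then have rn: "r < n" using r by simp
  have split: "(\<Sum>j<n. g j) = (\<Sum>j<r. g j) + (\<Sum>j\<in>{r..<n}. g j)" for g :: "nat \<Rightarrow> real"
    using r by (metis sum.lessThan_Suc atLeast0LessThan sum.atLeastLessThan_concat zero_le)
  have 1: "a r * (\<Sum>j<r. w j) \<le> (\<Sum>j<r. a j * w j)"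
    unfolding sum_distrib_left using rn a w(1) by (intro sum_mono mult_right_mono) auto
  have 2: "(\<Sum>j\<in>{r..<n}. a j * (1 - w j)) \<le> a r * (\<Sum>j\<in>{r..<n}. 1 - w j)"
    unfolding sum_distrib_left using a w(2) by (intro sum_mono mult_right_mono) auto
  have "(\<Sum>j\<in>{r..<n}. 1 - w j) = (\<Sum>j<r. w j)"
    using w(3) split[of w] by (simp add: sum_subtractf)
  then have "(\<Sum>j\<in>{r..<n}. a j * (1 - w j)) \<le> (\<Sum>j<r. a j * w j)" using 1 2 by simp
  then show ?thesis
    by (simp add: split[of "\<lambda>j. a j * w j"] right_diff_distrib sum_subtractf)
qed

text \<open>In the left basis \<open>P\<close> the competitor has no rows from \<open>r\<close> on,
  so its error is at least the part of \<open>M\<close> in those rows. That part is a weighted sum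
  of squared singular values, bounded below by the tail, which is the error of the truncated
  SVD.\<close>

lemma eckart_young:
  assumes svd: "is_svd n1 n2 M U S V" and r: "r \<le> min n1 n2"
    and P: "unitary n1 P" and G: "\<And>p j. r \<le> p \<Longrightarrow> G p j = 0"
  defines "T \<equiv> (\<lambda>i j. if i = j \<and> r \<le> i then 0 else S i j)"
  shows "fro n1 n2 (\<lambda>i j. M i j - mmul n2 (mmul n1 U T) (adj V) i j)
         \<le> fro n1 n2 (\<lambda>i j. M i j - mmul n1 P G i j)"
proof -
  have U: "unitary n1 U" and V: "unitary n2 V" and S: "supp n1 n2 S"
    and diag: "\<And>i j. i \<noteq> j \<Longrightarrow> S i j = 0"
    and M: "M = mmul n2 (mmul n1 U S) (adj V)"
    using svd by (auto simp: is_svd_def)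
  \<comment> \<open>Being 0 outside the box, \<open>a\<close> stays nonincreasing on all indices
    below \<open>n1\<close> and can be paired with the square matrix \<open>L\<close>.\<close>
  define a where "a j = (cmod (S j j))\<^sup>2" for j
  have a0: "a j = 0" if "\<not> j < min n1 n2" for j
    using S that by (auto simp: supp_def a_def)
  have adec: "a j \<le> a i" if "i \<le> j" for i j
  proof (cases "j < min n1 n2")
    case True
    then have "Im (S j j) = 0" "Im (S i i) = 0" "0 \<le> Re (S j j)" "Re (S j j) \<le> Re (S i i)"
      using svd that unfolding is_svd_def by auto
    then show ?thesis unfolding a_def cmod_power2 by (simp add: power_mono)
  next
    case False then show ?thesis using a0[of j] by (simp add: a_def)
  qed
  have diag_sum: "(\<Sum>j<n2. (cmod (c i * S i j))\<^sup>2) = (cmod (c i))\<^sup>2 * a i" if "i < n1" for c :: "nat \<Rightarrow> complex" and i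
  proof (cases "i < n2")
    case True
    have "(\<Sum>j<n2. (cmod (c i * S i j))\<^sup>2) = (\<Sum>j<n2. if j = i then (cmod (c i))\<^sup>2 * a i else 0)"
      using diag by (intro sum.cong) (auto simp: a_def norm_mult power_mult_distrib)
    then show ?thesis using True by simp
  next
    case False
    then have "S i j = 0" if "j < n2" for j using that diag[of i j] by auto
    then show ?thesis using False a0[of i] by simp
  qed
  have "fro n1 n2 (\<lambda>i j. M i j - mmul n2 (mmul n1 U T) (adj V) i j)
      = fro n1 n2 (mmul n2 (mmul n1 U (\<lambda>i j. S i j - T i j)) (adj V))"
    by (simp add: M mmul_diff_left mmul_diff_right)
  also have "\<dots> = fro n1 n2 (\<lambda>i j. S i j - T i j)"
    using U V by (simp add: fro_isometry_right fro_isometry unitary_def)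
  also have "\<dots> = (\<Sum>i<n1. if r \<le> i then a i else 0)"
    unfolding fro_def
  proof (intro sum.cong refl)
    fix i assume i: "i \<in> {..<n1}"
    have "(\<Sum>j<n2. (cmod (S i j - T i j))\<^sup>2) = (\<Sum>j<n2. (cmod ((if r \<le> i then 1 else 0) * S i j))\<^sup>2)"
      using diag by (intro sum.cong) (auto simp: T_def)
    then show "(\<Sum>j<n2. (cmod (S i j - T i j))\<^sup>2) = (if r \<le> i then a i else 0)"
      using diag_sum[of i "\<lambda>i. if r \<le> i then 1 else 0"] i by simp
  qed
  also have "\<dots> = (\<Sum>i\<in>{r..<n1}. a i)"
    by (simp add: sum.If_cases) (rule arg_cong[where f = "sum a"], auto)
  finally have lhs: "fro n1 n2 (\<lambda>i j. M i j - mmul n2 (mmul n1 U T) (adj V) i j) = (\<Sum>i\<in>{r..<n1}. a i)" .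

  define L where "L = mmul n1 (adj P) U"
  have L: "unitary n1 L" unfolding L_def by (intro unitary_mmul unitary_adj P U)
  \<comment> \<open>The share of column \<open>j\<close> of \<open>U\<close> outside the span of the
    first \<open>r\<close> columns of \<open>P\<close>. Unit columns of \<open>L\<close> give
    \<open>w j \<le> 1\<close>, unit rows give the total weight \<open>n1 - r\<close>.\<close>
  define w where "w j = (\<Sum>i\<in>{r..<n1}. (cmod (L i j))\<^sup>2)" for j
  have colsum: "(\<Sum>i<n1. (cmod (L i j))\<^sup>2) = 1" if "j < n1" for j
  proof -
    have "complex_of_real (\<Sum>i<n1. (cmod (L i j))\<^sup>2) = mmul n1 (adj L) L j j"
      by (simp add: mmul_def adj_def complex_norm_square mult.commute flip: of_real_power)
    also have "\<dots> = 1" using L that by (simp add: unitary_def idm_def)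
    finally show ?thesis using of_real_eq_1_iff by blast
  qed
  have rowsum: "(\<Sum>j<n1. (cmod (L i j))\<^sup>2) = 1" if "i < n1" for i
  proof -
    have "complex_of_real (\<Sum>j<n1. (cmod (L i j))\<^sup>2) = mmul n1 L (adj L) i i"
      by (simp add: mmul_def adj_def complex_norm_square flip: of_real_power)
    also have "\<dots> = 1" using L that by (simp add: unitary_def idm_def)
    finally show ?thesis using of_real_eq_1_iff by blast
  qed
  have w0: "0 \<le> w j" for j by (simp add: w_def sum_nonneg)
  have w1: "w j \<le> 1" if "j < n1" for j
    unfolding w_def colsum[OF that, symmetric] by (intro sum_mono2) auto
  have "(\<Sum>j<n1. w j) = (\<Sum>i\<in>{r..<n1}. \<Sum>j<n1. (cmod (L i j))\<^sup>2)"
    unfolding w_def by (rule sum.swap)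
  also have "\<dots> = (\<Sum>i\<in>{r..<n1}. 1)" by (intro sum.cong) (auto simp: rowsum)
  finally have w2: "(\<Sum>j<n1. w j) = real (n1 - r)" by simp

  have "mmul n2 (mmul n1 (adj P) M) V = mmul n1 L (mmul n2 S (mmul n2 (adj V) V))"
    by (simp add: M L_def mmul_assoc)
  also have "\<dots> = mmul n1 L S" using V by (simp add: unitary_def mmul_idm_right[OF S])
  finally have eM: "mmul n2 (mmul n1 (adj P) M) V = mmul n1 L S" .
  define H where "H = mmul n2 (mmul n1 (idm n1) G) V"
  have H0: "H i j = 0" if "r \<le> i" for i j
  proof -
    have "mmul n1 (idm n1) G i p = 0" for p
      using that sum_idm(1)[of i n1 "\<lambda>q. G q p"] G by (cases "i < n1") (simp_all add: mmul_def idm_def)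
    then show ?thesis by (simp add: H_def mmul_def)
  qed
  have eB: "mmul n2 (mmul n1 (adj P) (mmul n1 P G)) V = H"
    using P by (simp add: H_def unitary_def flip: mmul_assoc)
  have "fro n1 n2 (\<lambda>i j. M i j - mmul n1 P G i j)
      = fro n1 n2 (mmul n2 (mmul n1 (adj P) (\<lambda>i j. M i j - mmul n1 P G i j)) V)"
    using P V by (simp add: fro_isometry_right fro_isometry unitary_def)
  also have "\<dots> = fro n1 n2 (\<lambda>i j. mmul n1 L S i j - H i j)"
    by (simp add: mmul_diff_right mmul_diff_left eM eB)
  finally have eD: "fro n1 n2 (\<lambda>i j. M i j - mmul n1 P G i j) = fro n1 n2 (\<lambda>i j. mmul n1 L S i j - H i j)" .
  \<comment> \<open>Only the rows from \<open>r\<close> on are kept, and there the competitor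
    \<open>H\<close> vanishes.\<close>
  have le: "(\<Sum>i\<in>{r..<n1}. \<Sum>j<n2. (cmod (mmul n1 L S i j - H i j))\<^sup>2) \<le> fro n1 n2 (\<lambda>i j. M i j - mmul n1 P G i j)"
    unfolding eD unfolding fro_def by (intro sum_mono2) (auto intro: sum_nonneg)
  have "(\<Sum>i\<in>{r..<n1}. \<Sum>j<n2. (cmod (mmul n1 L S i j - H i j))\<^sup>2)
      = (\<Sum>i\<in>{r..<n1}. \<Sum>j<n1. (cmod (L i j))\<^sup>2 * a j)"
  proof (rule sum.cong[OF refl])
    fix i assume "i \<in> {r..<n1}"
    then have i: "r \<le> i" by simp
    have e: "(cmod (mmul n1 L S i j))\<^sup>2 = (\<Sum>p<n1. (cmod (L i p * S p j))\<^sup>2)" for j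
    proof (cases "j < n1")
      case True
      have "mmul n1 L S i j = (\<Sum>p<n1. if p = j then L i j * S j j else 0)"
        unfolding mmul_def using diag by (intro sum.cong) auto
      moreover have "(\<Sum>p<n1. (cmod (L i p * S p j))\<^sup>2) = (\<Sum>p<n1. if p = j then (cmod (L i j * S j j))\<^sup>2 else 0)"
        using diag by (intro sum.cong) auto
      ultimately show ?thesis using True by simp
    next
      case False
      then have "p \<noteq> j" if "p < n1" for p using that by auto
      then show ?thesis using diag by (simp add: mmul_def)
    qed
    have "(\<Sum>j<n2. (cmod (mmul n1 L S i j - H i j))\<^sup>2) = (\<Sum>j<n2. \<Sum>p<n1. (cmod (L i p * S p j))\<^sup>2)"
      using H0[OF i] e by simp
    also have "\<dots> = (\<Sum>p<n1. \<Sum>j<n2. (cmod (L i p * S p j))\<^sup>2)" by (rule sum.swap)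
    also have "\<dots> = (\<Sum>p<n1. (cmod (L i p))\<^sup>2 * a p)"
      by (intro sum.cong refl) (use diag_sum in auto)
    finally show "(\<Sum>j<n2. (cmod (mmul n1 L S i j - H i j))\<^sup>2) = (\<Sum>p<n1. (cmod (L i p))\<^sup>2 * a p)" .
  qed
  also have "\<dots> = (\<Sum>j<n1. \<Sum>i\<in>{r..<n1}. (cmod (L i j))\<^sup>2 * a j)" by (rule sum.swap)
  also have "\<dots> = (\<Sum>j<n1. a j * w j)"
    by (simp add: w_def sum_distrib_left mult.commute)
  finally have rhs: "(\<Sum>j<n1. a j * w j) \<le> fro n1 n2 (\<lambda>i j. M i j - mmul n1 P G i j)" using le by simp
  show ?thesis
    using weighted_sum_ge_tail[of r n1 a w] adec w0 w1 w2 r lhs rhs by simp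
qed

section \<open>Existence of singular value decompositions\<close>

definition cinner :: "nat \<Rightarrow> (nat \<Rightarrow> complex) \<Rightarrow> (nat \<Rightarrow> complex) \<Rightarrow> complex" where
  "cinner n x y = (\<Sum>i<n. cnj (x i) * y i)"

definition nsq :: "nat \<Rightarrow> (nat \<Rightarrow> complex) \<Rightarrow> real" where
  "nsq n x = (\<Sum>i<n. (cmod (x i))\<^sup>2)"

definition kvec :: "complex set \<Rightarrow> nat \<Rightarrow> (nat \<Rightarrow> complex) set" where
  "kvec K n = {x. (\<forall>i. x i \<in> K) \<and> (\<forall>i\<ge>n. x i = 0)}"

definition mvec :: "nat \<Rightarrow> cmat \<Rightarrow> (nat \<Rightarrow> complex) \<Rightarrow> nat \<Rightarrow> complex" where
  "mvec n M x = (\<lambda>i. \<Sum>j<n. M i j * x j)"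

lemma cinner_self: "cinner n x x = complex_of_real (nsq n x)"
  by (simp add: cinner_def nsq_def complex_norm_square mult.commute flip: of_real_power)

lemma cinner_commute: "cinner n y x = cnj (cinner n x y)"
  by (simp add: cinner_def mult.commute)

lemma nsq_nonneg: "0 \<le> nsq n x"
  by (simp add: nsq_def sum_nonneg)

lemma nsq_eq_0: "nsq n x = 0 \<longleftrightarrow> (\<forall>i<n. x i = 0)"
  unfolding nsq_def by (subst sum_nonneg_eq_0_iff) auto

lemma cinner_add_right: "cinner n x (\<lambda>i. y i + c * z i) = cinner n x y + c * cinner n x z"
  by (simp add: cinner_def algebra_simps sum.distrib sum_distrib_left)

lemma cinner_scale_right: "cinner n x (\<lambda>i. c * z i) = c * cinner n x z"
  by (simp add: cinner_def algebra_simps sum_distrib_left)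

lemma cinner_scale_left: "cinner n (\<lambda>i. c * z i) x = cnj c * cinner n z x"
  by (simp add: cinner_def algebra_simps sum_distrib_left)

lemma nsq_scale: "nsq n (\<lambda>i. c * x i) = (cmod c)\<^sup>2 * nsq n x"
  by (simp add: nsq_def norm_mult power_mult_distrib sum_distrib_left)

lemma nsq_add: "nsq n (\<lambda>i. x i + c * y i) = nsq n x + 2 * Re (c * cinner n x y) + (cmod c)\<^sup>2 * nsq n y"
proof -
  have "complex_of_real (nsq n (\<lambda>i. x i + c * y i)) =
      cinner n x x + (c * cinner n x y + cnj (c * cinner n x y)) + c * cnj c * cinner n y y"
    by (simp add: cinner_self[symmetric]) (simp add: cinner_def algebra_simps sum.distrib sum_distrib_left)
  also have "\<dots> = complex_of_real (nsq n x + 2 * Re (c * cinner n x y) + (cmod c)\<^sup>2 * nsq n y)"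
    by (simp add: complex_add_cnj cinner_self complex_norm_square del: complex_cnj_mult flip: of_real_power)
  finally show ?thesis using of_real_eq_iff by blast
qed

lemma mvec_add: "mvec n M (\<lambda>i. x i + c * y i) = (\<lambda>i. mvec n M x i + c * mvec n M y i)"
  by (simp add: mvec_def fun_eq_iff algebra_simps sum.distrib sum_distrib_left)

lemma mvec_scale: "mvec n M (\<lambda>i. c * y i) = (\<lambda>i. c * mvec n M y i)"
  by (simp add: mvec_def fun_eq_iff algebra_simps sum_distrib_left)

text \<open>
  The decomposition is needed over both fields: Fourier slices that are their own mirror image are
  real and must have real factors, or else the factor tensors would not be real.
\<close>

locale real_or_complex =
  fixes K :: "complex set"
  assumes K: "K = \<real> \<or> K = UNIV"
begin

lemma K_add: "x \<in> K \<Longrightarrow> y \<in> K \<Longrightarrow> x + y \<in> K"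
  and K_mult: "x \<in> K \<Longrightarrow> y \<in> K \<Longrightarrow> x * y \<in> K"
  and K_cnj: "x \<in> K \<Longrightarrow> cnj x \<in> K"
  and K_of_real: "complex_of_real r \<in> K"
  and K_sum: "(\<And>i. i \<in> I \<Longrightarrow> f i \<in> K) \<Longrightarrow> sum f I \<in> K"
  using K by (auto simp: Reals_cnj_iff intro: sum_in_Reals)

lemma K_0: "0 \<in> K"
  using K_of_real[of 0] by simp

lemma kvec_scale: "x \<in> kvec K n \<Longrightarrow> c \<in> K \<Longrightarrow> (\<lambda>i. c * x i) \<in> kvec K n"
  by (simp add: kvec_def K_mult)

lemma kvec_add: "x \<in> kvec K n \<Longrightarrow> y \<in> kvec K n \<Longrightarrow> (\<lambda>i. x i + y i) \<in> kvec K n"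
  by (simp add: kvec_def K_add)

lemma cinner_in_K: "x \<in> kvec K n \<Longrightarrow> y \<in> kvec K n \<Longrightarrow> cinner n x y \<in> K"
  by (simp add: kvec_def cinner_def K_mult K_cnj K_sum)

lemma mvec_in_kvec:
  assumes "supp n m M" "\<And>i j. M i j \<in> K" "x \<in> kvec K m"
  shows "mvec m M x \<in> kvec K n"
  using assms by (simp add: kvec_def mvec_def supp_def K_mult K_sum)

text \<open>Orthogonality to \<open>m\<close> vectors amounts to \<open>m\<close> homogeneous
  equations in \<open>n\<close> unknowns; a nontrivial solution is cut off beyond \<open>n\<close>
  and normalised.\<close>

lemma exists_orthogonal_unit_vector:
  assumes "m < n" and vs: "\<And>j. j < m \<Longrightarrow> vs j \<in> kvec K n"
  shows "\<exists>x\<in>kvec K n. nsq n x = 1 \<and> (\<forall>j<m. cinner n (vs j) x = 0)"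
proof -
  define a where "a j i = (if j < m then cnj (vs j i) else 0)" for j i
  have "a j i \<in> K" for j i using vs by (auto simp: a_def kvec_def K_cnj K_0)
  then obtain x where x: "\<And>j. x j \<in> K" "\<exists>j\<in>{..<n}. x j \<noteq> 0" "\<forall>j<m. (\<Sum>i<n. a j i * x i) = 0"
    using homogeneous_system_nontrivial[OF K, of "{..<n}" m a] assms(1) by auto
  define y where "y i = (if i < n then x i else 0)" for i
  have y: "y \<in> kvec K n" using x(1) by (simp add: kvec_def y_def K_0)
  define s where "s = nsq n y"
  have "s \<noteq> 0" using x(2) by (auto simp: s_def nsq_eq_0 y_def)
  then have s: "0 < s" using nsq_nonneg[of n y] by (simp add: s_def)
  define z where "z i = complex_of_real (1 / sqrt s) * y i" for i
  have "z \<in> kvec K n" unfolding z_def by (intro kvec_scale y K_of_real)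
  moreover have "nsq n z = 1"
    unfolding z_def nsq_scale using s by (simp add: s_def[symmetric] norm_divide power_divide)
  moreover have "cinner n (vs j) z = 0" if "j < m" for j
  proof -
    have "cinner n (vs j) y = (\<Sum>i<n. a j i * x i)"
      using that by (simp add: cinner_def a_def y_def)
    then show ?thesis using x(3) that unfolding z_def cinner_scale_right by simp
  qed
  ultimately show ?thesis by blast
qed

text \<open>Tychonoff: coordinates below \<open>n\<close> range over the unit disc and all others
  over \<open>{0}\<close>. The remaining conditions are closed, \<open>K\<close> itself being
  closed.\<close>

lemma compact_orthogonal_unit_vectors:
  "compact {x \<in> kvec K n. nsq n x = 1 \<and> (\<forall>j<m. cinner n (vs j) x = 0)}" (is "compact ?A")
proof -
  define B where "B = Pi\<^sub>E UNIV (\<lambda>i. if i < n then cball (0::complex) 1 else {0})"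
  have "compactin (product_topology (\<lambda>i. euclidean) UNIV) B"
    unfolding B_def compactin_PiE by auto
  then have B: "compact B" by (simp add: euclidean_product_topology)
  have "closed K" using K closed_complex_Reals by auto
  define C where "C = {x. (\<forall>i. x i \<in> K) \<and> nsq n x = 1 \<and> (\<forall>j<m. cinner n (vs j) x = 0)}"
  have cK: "closed {x. (x i :: complex) \<in> K}" for i :: nat
    using closed_vimage[OF \<open>closed K\<close> continuous_on_product_coordinates[of i]] by (simp add: vimage_def)
  have C: "closed C"
    unfolding C_def nsq_def cinner_def
    by (intro closed_Collect_conj closed_Collect_all closed_Collect_imp closed_Collect_eq cK
        continuous_intros continuous_on_product_coordinates open_Collect_const)
  have "?A = B \<inter> C"
  proof (intro equalityI subsetI)
    fix x assume x: "x \<in> ?A"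
    have "cmod (x i) \<le> 1" if "i < n" for i
    proof -
      have "(cmod (x i))\<^sup>2 \<le> nsq n x"
        unfolding nsq_def using that by (intro member_le_sum) auto
      then show ?thesis using x by (simp add: power_le_one_iff)
    qed
    then show "x \<in> B \<inter> C" using x by (auto simp: B_def C_def kvec_def)
  next
    fix x assume x: "x \<in> B \<inter> C"
    then have "x i \<in> (if i < n then cball 0 1 else {0})" for i
      by (auto simp: B_def PiE_def Pi_def)
    then have "x i = 0" if "i \<ge> n" for i using that by (metis not_less singletonD)
    then show "x \<in> ?A" using x by (auto simp: C_def kvec_def)
  qed
  then show ?thesis using B C compact_Int_closed by simp
qed

text \<open>The extreme value theorem on the compact set of admissible unit vectors; rescaling
  extends the bound to every admissible \<open>z\<close>.\<close>

lemma exists_maximising_vector: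
  assumes "m < n" and vs: "\<And>j. j < m \<Longrightarrow> vs j \<in> kvec K n"
  shows "\<exists>x\<in>kvec K n. nsq n x = 1 \<and> (\<forall>j<m. cinner n (vs j) x = 0) \<and>
    (\<forall>z\<in>kvec K n. (\<forall>j<m. cinner n (vs j) z = 0) \<longrightarrow> nsq l (mvec n M z) \<le> nsq l (mvec n M x) * nsq n z)"
proof -
  let ?A = "{x \<in> kvec K n. nsq n x = 1 \<and> (\<forall>j<m. cinner n (vs j) x = 0)}"
  have ne: "?A \<noteq> {}" using exists_orthogonal_unit_vector[of m n vs, OF assms] by (auto simp: Bex_def)
  have "continuous_on UNIV (\<lambda>x. nsq l (mvec n M x))"
    unfolding nsq_def mvec_def by (intro continuous_intros continuous_on_product_coordinates)
  then have "continuous_on ?A (\<lambda>x. nsq l (mvec n M x))"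
    by (rule continuous_on_subset) simp
  then obtain x where x: "x \<in> ?A" and max: "\<And>z. z \<in> ?A \<Longrightarrow> nsq l (mvec n M z) \<le> nsq l (mvec n M x)"
    using continuous_attains_sup[OF compact_orthogonal_unit_vectors ne] by blast
  have "nsq l (mvec n M z) \<le> nsq l (mvec n M x) * nsq n z"
    if z: "z \<in> kvec K n" "\<forall>j<m. cinner n (vs j) z = 0" for z
  proof (cases "nsq n z = 0")
    case True
    then have "mvec n M z = (\<lambda>i. 0)" by (simp add: nsq_eq_0 mvec_def)
    then show ?thesis using True by (simp add: nsq_def)
  next
    case False
    then have pos: "0 < nsq n z" using nsq_nonneg[of n z] by simp
    let ?c = "complex_of_real (1 / sqrt (nsq n z))"
    have "(\<lambda>i. ?c * z i) \<in> ?A"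
      using kvec_scale[OF z(1) K_of_real] z(2) pos
      by (simp only: mem_Collect_eq nsq_scale cinner_scale_right) (simp add: norm_divide power_divide)
    then have "nsq l (mvec n M (\<lambda>i. ?c * z i)) \<le> nsq l (mvec n M x)" by (rule max)
    then show ?thesis
      unfolding mvec_scale nsq_scale using pos by (simp add: norm_divide power_divide field_simps)
  qed
  then show ?thesis using x by blast
qed

text \<open>Right singular vectors in variational form: each \<open>v i\<close> attains the operator
  norm of \<open>M\<close> on the orthogonal complement of its predecessors. The bound is stated
  homogeneously so that \<open>z\<close> need not be normalised.\<close>

definition greedy :: "nat \<Rightarrow> nat \<Rightarrow> cmat \<Rightarrow> nat \<Rightarrow> (nat \<Rightarrow> nat \<Rightarrow> complex) \<Rightarrow> bool" where
  "greedy l n M q v \<longleftrightarrow> (\<forall>i<q. v i \<in> kvec K n \<and> nsq n (v i) = 1 \<and> (\<forall>j<i. cinner n (v j) (v i) = 0) \<and>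
    (\<forall>z\<in>kvec K n. (\<forall>j<i. cinner n (v j) z = 0) \<longrightarrow> nsq l (mvec n M z) \<le> nsq l (mvec n M (v i)) * nsq n z))"

lemma greedy_exists: "q \<le> n \<Longrightarrow> \<exists>v. greedy l n M q v"
proof (induction q)
  case 0
  then show ?case by (simp add: greedy_def)
next
  case (Suc q)
  then obtain v where v: "greedy l n M q v" by auto
  obtain x where x: "x \<in> kvec K n" "nsq n x = 1" "\<forall>j<q. cinner n (v j) x = 0"
    "\<forall>z\<in>kvec K n. (\<forall>j<q. cinner n (v j) z = 0) \<longrightarrow> nsq l (mvec n M z) \<le> nsq l (mvec n M x) * nsq n z"
    using exists_maximising_vector[of q n v l M] v Suc.prems unfolding greedy_def by auto
  have "greedy l n M (Suc q) (v(q := x))"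
    unfolding greedy_def
  proof (intro allI impI)
    fix i assume "i < Suc q"
    then consider "i < q" | "i = q" by linarith
    then show "(v(q := x)) i \<in> kvec K n \<and> nsq n ((v(q := x)) i) = 1 \<and>
        (\<forall>j<i. cinner n ((v(q := x)) j) ((v(q := x)) i) = 0) \<and>
        (\<forall>z\<in>kvec K n. (\<forall>j<i. cinner n ((v(q := x)) j) z = 0) \<longrightarrow>
          nsq l (mvec n M z) \<le> nsq l (mvec n M ((v(q := x)) i)) * nsq n z)"
    proof cases
      case 1
      then have "(\<forall>j<i. (v(q := x)) j = v j)" "(v(q := x)) i = v i" by auto
      then show ?thesis using 1 v unfolding greedy_def by simp
    next
      case 2
      then have "(\<forall>j<i. (v(q := x)) j = v j)" "(v(q := x)) i = x" by auto
      then show ?thesis using 2 x by simp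
    qed
  qed
  then show ?case by blast
qed

text \<open>If the images of \<open>v i\<close> and \<open>v j\<close> had inner product \<open>cnj c \<noteq> 0\<close>, moving \<open>v i\<close> slightly towards
  \<open>c * v j\<close> would increase the maximised quotient to first order.\<close>

lemma greedy_images_orthogonal:
  assumes g: "greedy l n M q v" and M: "supp l n M" "\<And>i j. M i j \<in> K" and ij: "i < j" "j < q"
  shows "cinner l (mvec n M (v i)) (mvec n M (v j)) = 0"
proof (rule ccontr)
  let ?x = "mvec n M (v i)" and ?w = "mvec n M (v j)"
  assume nz: "cinner l ?x ?w \<noteq> 0"
  define c where "c = cnj (cinner l ?x ?w)"
  define \<sigma> where "\<sigma> = nsq l ?x"
  \<comment> \<open>Small enough that, up to the common factor \<open>(cmod c)\<^sup>2\<close>, the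
    second-order loss \<open>\<tau> * (\<tau> * \<sigma>)\<close> stays below the first-order gain
    \<open>2 * \<tau>\<close>.\<close>
  define \<tau> where "\<tau> = 1 / (\<sigma> + 1)"
  define z where "z = (\<lambda>p. v i p + (of_real \<tau> * c) * v j p)"
  have \<sigma>0: "0 \<le> \<sigma>" by (simp add: \<sigma>_def nsq_nonneg)
  have \<tau>: "0 < \<tau>" "\<tau> * \<sigma> < 1" using \<sigma>0 by (simp_all add: \<tau>_def)
  have vK: "v i \<in> kvec K n" "v j \<in> kvec K n" using g ij by (auto simp: greedy_def)
  have cK: "c \<in> K" unfolding c_def by (intro K_cnj cinner_in_K mvec_in_kvec M vK)
  have "z \<in> kvec K n"
    unfolding z_def by (intro kvec_add kvec_scale vK K_mult K_of_real cK)
  moreover have "\<forall>p<i. cinner n (v p) z = 0"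
    using g ij unfolding z_def cinner_add_right by (auto simp: greedy_def)
  ultimately have "nsq l (mvec n M z) \<le> \<sigma> * nsq n z"
    using g ij unfolding greedy_def \<sigma>_def by auto
  moreover have "nsq n z = 1 + \<tau>\<^sup>2 * (cmod c)\<^sup>2"
    using g ij unfolding z_def nsq_add by (auto simp: greedy_def norm_mult power_mult_distrib)
  moreover have "nsq l (mvec n M z) = \<sigma> + 2 * \<tau> * (cmod c)\<^sup>2 + \<tau>\<^sup>2 * (cmod c)\<^sup>2 * nsq l ?w"
  proof -
    have "Re (of_real \<tau> * c * cinner l ?x ?w) = \<tau> * (cmod c)\<^sup>2"
      unfolding c_def cmod_power2 by (simp add: power2_eq_square algebra_simps)
    then show ?thesis
      unfolding z_def mvec_add nsq_add by (simp add: \<sigma>_def norm_mult power_mult_distrib)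
  qed
  moreover have "0 \<le> \<tau>\<^sup>2 * (cmod c)\<^sup>2 * nsq l ?w" by (simp add: nsq_nonneg)
  ultimately have "2 * \<tau> * (cmod c)\<^sup>2 \<le> \<tau> * (\<tau> * \<sigma>) * (cmod c)\<^sup>2"
    by (simp add: algebra_simps power2_eq_square)
  moreover have "0 < (cmod c)\<^sup>2" using nz by (simp add: c_def)
  ultimately have "2 * \<tau> \<le> \<tau> * (\<tau> * \<sigma>)" by (rule mult_right_le_imp_le)
  moreover have "\<tau> * (\<tau> * \<sigma>) < \<tau> * 1" using \<tau> by (intro mult_strict_left_mono)
  ultimately show False using \<tau>(1) by linarith
qed

text \<open>Nonzero images are normalised; for a zero image, or beyond the \<open>k\<close> images,
  any unit vector orthogonal to the previous ones serves. Decreasing norms put the zero images last,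
  so no arbitrary vector precedes a nonzero image to which it would have to be orthogonal.\<close>

lemma left_singular_vectors:
  assumes w: "\<And>i. i < k \<Longrightarrow> w i \<in> kvec K n"
    and orth: "\<And>i j. i < j \<Longrightarrow> j < k \<Longrightarrow> cinner n (w i) (w j) = 0"
    and dec: "\<And>i j. i \<le> j \<Longrightarrow> j < k \<Longrightarrow> nsq n (w j) \<le> nsq n (w i)"
    and "q \<le> n"
  shows "\<exists>u. \<forall>i<q. u i \<in> kvec K n \<and> nsq n (u i) = 1 \<and> (\<forall>j<i. cinner n (u j) (u i) = 0) \<and>
    (i < k \<longrightarrow> w i = (\<lambda>p. of_real (sqrt (nsq n (w i))) * u i p))"
  using \<open>q \<le> n\<close>
proof (induction q)
  case 0
  then show ?case by simp
next
  case (Suc q)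
  then obtain u where u: "\<And>i. i < q \<Longrightarrow> u i \<in> kvec K n" "\<And>i. i < q \<Longrightarrow> nsq n (u i) = 1"
    "\<And>i j. i < q \<Longrightarrow> j < i \<Longrightarrow> cinner n (u j) (u i) = 0"
    "\<And>i. i < q \<Longrightarrow> i < k \<Longrightarrow> w i = (\<lambda>p. of_real (sqrt (nsq n (w i))) * u i p)"
    by auto
  have "\<exists>x\<in>kvec K n. nsq n x = 1 \<and> (\<forall>j<q. cinner n (u j) x = 0) \<and>
    (q < k \<longrightarrow> w q = (\<lambda>p. of_real (sqrt (nsq n (w q))) * x p))"
  proof (cases "q < k \<and> nsq n (w q) \<noteq> 0")
    case True
    define s where "s = nsq n (w q)"
    have s: "0 < s" using True nsq_nonneg[of n "w q"] by (simp add: s_def)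
    define x where "x = (\<lambda>p. of_real (1 / sqrt s) * w q p)"
    have "x \<in> kvec K n" unfolding x_def using True w by (intro kvec_scale K_of_real) auto
    moreover have "nsq n x = 1"
      unfolding x_def nsq_scale using s by (simp add: s_def[symmetric] norm_divide power_divide)
    moreover have "w q = (\<lambda>p. of_real (sqrt s) * x p)"
      using s by (simp add: x_def fun_eq_iff flip: of_real_mult)
    moreover have "cinner n (u j) x = 0" if "j < q" for j
    proof -
      have "s \<le> nsq n (w j)" using that True by (simp add: s_def dec)
      then have nz: "complex_of_real (sqrt (nsq n (w j))) \<noteq> 0" using s by simp
      have "cinner n (w j) (w q) = 0" using that True orth by blast
      then have "cinner n (\<lambda>p. of_real (sqrt (nsq n (w j))) * u j p) (w q) = 0"
        using u(4)[OF that] that True by simp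
      then have "cinner n (u j) (w q) = 0"
        using nz unfolding cinner_scale_left by simp
      then show ?thesis unfolding x_def cinner_scale_right by simp
    qed
    ultimately show ?thesis by (auto simp: s_def)
  next
    case False
    obtain x where x: "x \<in> kvec K n" "nsq n x = 1" "\<forall>j<q. cinner n (u j) x = 0"
      using exists_orthogonal_unit_vector[of q n u] Suc.prems u(1) by auto
    have "w q = (\<lambda>p. of_real (sqrt (nsq n (w q))) * x p)" if "q < k"
    proof
      fix p
      have "w q p = 0" using False that w[OF that] by (cases "p < n") (auto simp: nsq_eq_0 kvec_def)
      then show "w q p = of_real (sqrt (nsq n (w q))) * x p" using False that by simp
    qed
    then show ?thesis using x by blast
  qed
  then obtain x where x: "x \<in> kvec K n" "nsq n x = 1" "\<forall>j<q. cinner n (u j) x = 0"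
    "q < k \<longrightarrow> w q = (\<lambda>p. of_real (sqrt (nsq n (w q))) * x p)" by blast
  show ?case
  proof (intro exI[of _ "u(q := x)"] allI impI)
    fix i assume "i < Suc q"
    then consider "i < q" | "i = q" by linarith
    then show "(u(q := x)) i \<in> kvec K n \<and> nsq n ((u(q := x)) i) = 1 \<and>
        (\<forall>j<i. cinner n ((u(q := x)) j) ((u(q := x)) i) = 0) \<and>
        (i < k \<longrightarrow> w i = (\<lambda>p. of_real (sqrt (nsq n (w i))) * (u(q := x)) i p))"
    proof cases
      case 1
      then have "(\<forall>j<i. (u(q := x)) j = u j)" "(u(q := x)) i = u i" by auto
      then show ?thesis using 1 u(1-3) u(4)[OF 1] by simp
    next
      case 2
      then have "(\<forall>j<i. (u(q := x)) j = u j)" "(u(q := x)) i = x" by auto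
      then show ?thesis using 2 x by simp
    qed
  qed
qed

definition from_columns :: "nat \<Rightarrow> (nat \<Rightarrow> nat \<Rightarrow> complex) \<Rightarrow> cmat" where
  "from_columns n v = (\<lambda>i j. if j < n then v j i else 0)"

lemma unitary_from_columns:
  assumes v: "\<And>i. i < n \<Longrightarrow> v i \<in> kvec K n" "\<And>i. i < n \<Longrightarrow> nsq n (v i) = 1"
    "\<And>i j. i < n \<Longrightarrow> j < i \<Longrightarrow> cinner n (v j) (v i) = 0"
  shows "unitary n (from_columns n v)"
proof (rule unitaryI)
  show "supp n n (from_columns n v)" using v(1) by (auto simp: supp_def from_columns_def kvec_def)
  show "mmul n (adj (from_columns n v)) (from_columns n v) = idm n"
  proof (intro ext)
    fix i j
    show "mmul n (adj (from_columns n v)) (from_columns n v) i j = idm n i j"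
    proof (cases "i < n \<and> j < n")
      case True
      then have "mmul n (adj (from_columns n v)) (from_columns n v) i j = cinner n (v i) (v j)"
        by (simp add: mmul_def adj_def from_columns_def cinner_def)
      also have "\<dots> = idm n i j"
        using True v(2,3) cinner_commute[of n "v i" "v j"]
        by (cases i j rule: linorder_cases) (auto simp: idm_def cinner_self)
      finally show ?thesis .
    next
      case False
      then show ?thesis by (auto simp: mmul_def adj_def from_columns_def idm_def)
    qed
  qed
qed

text \<open>The images of the greedy vectors are the columns of \<open>M V\<close>, and normalising
  them gives \<open>M V = U S\<close>; unitarity then moves \<open>V\<close> to the other
  side.\<close>

lemma svd_exists:
  assumes M: "supp n1 n2 M" "\<And>i j. M i j \<in> K"
  shows "\<exists>U S V. is_svd n1 n2 M U S V \<and> (\<forall>i j. U i j \<in> K) \<and> (\<forall>i j. V i j \<in> K)"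
proof -
  obtain v where g: "greedy n1 n2 M n2 v" using greedy_exists[of n2 n2] by auto
  then have v: "\<And>i. i < n2 \<Longrightarrow> v i \<in> kvec K n2" "\<And>i. i < n2 \<Longrightarrow> nsq n2 (v i) = 1"
    "\<And>i j. i < n2 \<Longrightarrow> j < i \<Longrightarrow> cinner n2 (v j) (v i) = 0"
    by (auto simp: greedy_def)
  define w where "w i = mvec n2 M (v i)" for i
  have w: "w i \<in> kvec K n1" if "i < n2" for i
    unfolding w_def by (intro mvec_in_kvec M v that)
  have orth: "cinner n1 (w i) (w j) = 0" if "i < j" "j < n2" for i j
    unfolding w_def using greedy_images_orthogonal[OF g M that] .
  have dec: "nsq n1 (w j) \<le> nsq n1 (w i)" if "i \<le> j" "j < n2" for i j
  proof (cases "i = j")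
    case False
    then have "\<forall>p<i. cinner n2 (v p) (v j) = 0" using that v(3) by auto
    moreover have "i < n2" "v j \<in> kvec K n2" using that v(1) by auto
    ultimately have "nsq n1 (w j) \<le> nsq n1 (w i) * nsq n2 (v j)"
      using g unfolding greedy_def w_def by blast
    then show ?thesis using v(2) that by simp
  qed simp
  obtain u where u: "\<And>i. i < n1 \<Longrightarrow> u i \<in> kvec K n1" "\<And>i. i < n1 \<Longrightarrow> nsq n1 (u i) = 1"
    "\<And>i j. i < n1 \<Longrightarrow> j < i \<Longrightarrow> cinner n1 (u j) (u i) = 0"
    and wu: "\<And>i. i < n1 \<Longrightarrow> i < n2 \<Longrightarrow> w i = (\<lambda>p. of_real (sqrt (nsq n1 (w i))) * u i p)"
    using left_singular_vectors[of n2 w n1 n1, OF w orth dec] by auto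
  define U where "U = from_columns n1 u"
  define V where "V = from_columns n2 v"
  define S :: cmat where "S = (\<lambda>i j. if i = j \<and> i < n1 \<and> i < n2 then of_real (sqrt (nsq n1 (w i))) else 0)"
  have U: "unitary n1 U" unfolding U_def by (rule unitary_from_columns) (use u in auto)
  have V: "unitary n2 V" unfolding V_def by (rule unitary_from_columns) (use v in auto)
  \<comment> \<open>These columns of \<open>M V\<close> lie beyond the width of \<open>U\<close>. A
    nonzero one would make all earlier images nonzero, and so be orthogonal to every column of
    \<open>U\<close>, a complete orthonormal basis.\<close>
  have w0: "w j p = 0" if "n1 \<le> j" "j < n2" for j p
  proof (rule ccontr)
    assume "w j p \<noteq> 0"
    moreover have "w j \<in> kvec K n1" using w that by blast
    ultimately have "nsq n1 (w j) \<noteq> 0" by (auto simp: nsq_eq_0 kvec_def not_le) (metis not_le)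
    then have pos: "0 < nsq n1 (w j)" using nsq_nonneg[of n1 "w j"] by simp
    have *: "cinner n1 (u i) (w j) = 0" if i: "i < n1" for i
    proof -
      have "nsq n1 (w j) \<le> nsq n1 (w i)" using dec[of i j] i \<open>n1 \<le> j\<close> \<open>j < n2\<close> by simp
      then have nz: "complex_of_real (sqrt (nsq n1 (w i))) \<noteq> 0" using pos by simp
      have "cinner n1 (w i) (w j) = 0" using orth i \<open>n1 \<le> j\<close> \<open>j < n2\<close> by simp
      then have "cinner n1 (\<lambda>p. of_real (sqrt (nsq n1 (w i))) * u i p) (w j) = 0"
        using wu[of i] i \<open>n1 \<le> j\<close> \<open>j < n2\<close> by simp
      then show ?thesis using nz unfolding cinner_scale_left by simp
    qed
    \<comment> \<open>The vector is written as a matrix with constant rows so that associativity of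
      \<open>mmul\<close> applies.\<close>
    have "mmul n1 (adj U) (\<lambda>p _. w j p) = (\<lambda>i q. 0)"
    proof (intro ext)
      fix i q :: nat
      show "mmul n1 (adj U) (\<lambda>p _. w j p) i q = 0"
        using * by (cases "i < n1") (simp_all add: mmul_def adj_def U_def from_columns_def cinner_def)
    qed
    then have "mmul n1 (mmul n1 U (adj U)) (\<lambda>p _. w j p) = (\<lambda>i q. 0)"
      by (simp add: mmul_assoc) (simp add: mmul_def)
    then have "mmul n1 (idm n1) (\<lambda>p _. w j p) p 0 = 0" using U by (simp add: unitary_def)
    moreover have "p < n1" using \<open>w j \<in> kvec K n1\<close> \<open>w j p \<noteq> 0\<close> by (auto simp: kvec_def not_le[symmetric])
    ultimately show False using \<open>w j p \<noteq> 0\<close> by (simp add: mmul_def sum_idm)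
  qed
  have MV: "mmul n2 M V = mmul n1 U S"
  proof (intro ext)
    fix i j
    show "mmul n2 M V i j = mmul n1 U S i j"
    proof (cases "j < n2")
      case False
      then have "mmul n2 M V i j = 0" "mmul n1 U S i j = 0"
        by (auto simp: mmul_def V_def S_def from_columns_def intro!: sum.neutral)
      then show ?thesis by simp
    next
      case True
      then have "mmul n2 M V i j = w j i" by (simp add: mmul_def V_def from_columns_def w_def mvec_def)
      also have "\<dots> = mmul n1 U S i j"
      proof (cases "j < n1")
        case False
        then have "mmul n1 U S i j = 0" by (auto simp: mmul_def S_def intro!: sum.neutral)
        then show ?thesis using w0 True False by simp
      next
        case jn: True
        have "mmul n1 U S i j = (\<Sum>p<n1. if p = j then of_real (sqrt (nsq n1 (w j))) * u j i else 0)"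
          unfolding mmul_def using True by (intro sum.cong) (auto simp: S_def U_def from_columns_def)
        also have "\<dots> = w j i" using jn wu[OF jn True] by (simp add: fun_eq_iff)
        finally show ?thesis by simp
      qed
      finally show ?thesis .
    qed
  qed
  have "M = mmul n2 M (mmul n2 V (adj V))" using V by (simp add: unitary_def mmul_idm_right[OF M(1)])
  also have "\<dots> = mmul n2 (mmul n1 U S) (adj V)" by (simp flip: MV add: mmul_assoc)
  finally have "M = mmul n2 (mmul n1 U S) (adj V)" .
  then have "is_svd n1 n2 M U S V"
    unfolding is_svd_def using U V dec by (auto simp: supp_def S_def nsq_nonneg)
  moreover have "U i j \<in> K" "V i j \<in> K" for i j
    using u(1) v(1) K_0 by (auto simp: U_def V_def from_columns_def kvec_def)
  ultimately show ?thesis by blast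
qed

end

section \<open>The discrete Fourier transform and the t-SVD\<close>

definition twiddle :: "nat \<Rightarrow> nat \<Rightarrow> nat \<Rightarrow> complex" where
  "twiddle n k l = cis (- 2 * pi * real k * real l / real n)"

text \<open>The index of frequency \<open>-k\<close>; the outer \<open>mod\<close> keeps 0 fixed. It
  governs both conjugation in the spectrum of a real tensor and the tube reversal in
  \<open>ttranspose\<close>.\<close>

definition refl_idx :: "nat \<Rightarrow> nat \<Rightarrow> nat" where
  "refl_idx n k = (n - k) mod n"

definition slice :: "nat \<Rightarrow> tensor \<Rightarrow> nat \<Rightarrow> cmat" where
  "slice n X k = (\<lambda>i j. dft3 n X i j k)"

definition mconj :: "cmat \<Rightarrow> cmat" where
  "mconj A = (\<lambda>i j. cnj (A i j))"

lemma twiddle_commute: "twiddle n k l = twiddle n l k"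
  by (simp add: twiddle_def mult_ac)

lemma twiddle_add: "twiddle n k (l + m) = twiddle n k l * twiddle n k m"
  by (simp add: twiddle_def cis_mult ring_distribs add_divide_distrib diff_divide_distrib)

lemma twiddle_0: "twiddle n k 0 = 1"
  by (simp add: twiddle_def)

lemma twiddle_period: "0 < n \<Longrightarrow> twiddle n k (n * q) = 1"
proof -
  assume "0 < n"
  then have "twiddle n k (n * q) = cis (2 * pi * (- (real k * real q)))"
    by (simp add: twiddle_def mult_ac)
  also have "\<dots> = 1" by (rule cis_multiple_2pi) simp
  finally show ?thesis .
qed

lemma twiddle_mod: "0 < n \<Longrightarrow> twiddle n k (l mod n) = twiddle n k l"
  by (metis mult_div_mod_eq twiddle_add twiddle_period mult_1)

lemma twiddle_mult_cnj: "twiddle n k l * cnj (twiddle n k l) = 1"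
  by (simp add: twiddle_def cis_cnj cis_mult)

lemma twiddle_refl: "0 < n \<Longrightarrow> k \<le> n \<Longrightarrow> twiddle n m (refl_idx n k) = cnj (twiddle n m k)"
proof -
  assume n: "0 < n" "k \<le> n"
  have "twiddle n m (n - k) * twiddle n m k = 1"
    using n twiddle_period[of n m 1] by (simp flip: twiddle_add)
  then have "twiddle n m (n - k) * (twiddle n m k * cnj (twiddle n m k)) = cnj (twiddle n m k)"
    by (simp flip: mult.assoc)
  then show ?thesis using n by (simp add: refl_idx_def twiddle_mod twiddle_mult_cnj)
qed

lemma refl_idx_less: "0 < n \<Longrightarrow> refl_idx n k < n"
  by (simp add: refl_idx_def)

lemma refl_idx_refl_idx: "k < n \<Longrightarrow> refl_idx n (refl_idx n k) = k"
  by (cases "k = 0") (simp_all add: refl_idx_def)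

text \<open>A geometric sum whose ratio is an \<open>n\<close>-th root of unity; ratio 1 would make
  \<open>n\<close> divide \<open>l - m\<close>, impossible for distinct indices below
  \<open>n\<close>.\<close>

lemma twiddle_orthogonal:
  assumes "l < n" "m < n"
  shows "(\<Sum>k<n. cnj (twiddle n k l) * twiddle n k m) = (if l = m then of_nat n else 0)"
proof (cases "l = m")
  case True
  then show ?thesis by (simp add: mult.commute twiddle_mult_cnj)
next
  case False
  have n: "0 < n" using assms by simp
  define \<theta> where "\<theta> = 2 * pi * (real l - real m) / real n"
  have pow: "cnj (twiddle n k l) * twiddle n k m = cis \<theta> ^ k" for k
  proof -
    have "cnj (twiddle n k l) * twiddle n k m = cis (2 * pi * real k * real l / real n - 2 * pi * real k * real m / real n)"
      by (simp add: twiddle_def cis_cnj cis_mult)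
    also have "2 * pi * real k * real l / real n - 2 * pi * real k * real m / real n = real k * \<theta>"
      using n by (simp add: \<theta>_def field_simps)
    finally show ?thesis by (simp add: Complex.DeMoivre)
  qed
  have "cis \<theta> \<noteq> 1"
  proof
    assume "cis \<theta> = 1"
    then have "cos \<theta> = 1" by (metis cis.sel(1) one_complex.sel(1))
    then obtain z :: int where "\<theta> = of_int z * 2 * pi" using cos_one_2pi_int by blast
    then have "2 * pi * (real l - real m) = 2 * pi * (of_int z * real n)"
      using n by (simp add: \<theta>_def field_simps)
    then have "real l - real m = of_int z * real n"
      using mult_left_cancel[of "2 * pi" "real l - real m"] pi_neq_zero by simp
    then have "of_int (int l - int m) = (of_int (z * int n) :: real)" by simp
    then have z: "int l - int m = z * int n" by (simp only: of_int_eq_iff)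
    then have "\<bar>z * int n\<bar> < int n" using assms by linarith
    then have "z = 0" using n by (simp add: abs_mult)
    then show False using z False by simp
  qed
  moreover have "cis \<theta> ^ n = 1"
  proof -
    have "cis \<theta> ^ n = cis (2 * pi * (real l - real m))"
      using n by (simp add: Complex.DeMoivre \<theta>_def)
    also have "\<dots> = 1" by (rule cis_multiple_2pi) simp
    finally show ?thesis .
  qed
  ultimately show ?thesis using False by (simp add: pow geometric_sum)
qed

lemma slice_eq: "slice n X k i j = (\<Sum>l<n. of_real (X i j l) * twiddle n k l)"
  by (simp add: slice_def dft3_def twiddle_def)

lemma slice_refl:
  assumes "k < n"
  shows "slice n X (refl_idx n k) = mconj (slice n X k)"
  using assms twiddle_refl[of n k]
  by (simp add: fun_eq_iff slice_eq mconj_def twiddle_commute[of n "refl_idx n k"] twiddle_commute[of n k])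

text \<open>Convolution theorem: a cyclic shift by \<open>l\<close> permutes the indices and
  multiplies the character by \<open>twiddle n k l\<close>.\<close>

lemma slice_circ_conv:
  assumes n: "0 < n"
  shows "(\<Sum>t<n. of_real (circ_conv n a b t) * twiddle n k t) =
    (\<Sum>l<n. of_real (a l) * twiddle n k l) * (\<Sum>m<n. of_real (b m) * twiddle n k m)"
proof -
  have "(\<Sum>t<n. of_real (circ_conv n a b t) * twiddle n k t) =
      (\<Sum>t<n. \<Sum>l<n. of_real (a l) * (of_real (b ((t + n - l) mod n)) * twiddle n k t))"
    by (simp add: circ_conv_def sum_distrib_right mult.assoc)
  also have "\<dots> = (\<Sum>l<n. \<Sum>t<n. of_real (a l) * (of_real (b ((t + n - l) mod n)) * twiddle n k t))"
    by (rule sum.swap)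
  also have "\<dots> = (\<Sum>l<n. of_real (a l) * twiddle n k l * (\<Sum>m<n. of_real (b m) * twiddle n k m))"
  proof (rule sum.cong[OF refl])
    fix l assume "l \<in> {..<n}"
    then have l: "l < n" by simp
    \<comment> \<open>The two shifts are mutually inverse; adding \<open>n\<close> before
      subtracting keeps subtraction on naturals exact.\<close>
    have inv1: "((t + n - l) mod n + l) mod n = t" if "t < n" for t
    proof -
      have "((t + n - l) mod n + l) mod n = (t + n - l + l) mod n" by (rule mod_add_left_eq)
      then show ?thesis using that l by simp
    qed
    have inv2: "((m + l) mod n + n - l) mod n = m" if "m < n" for m
    proof -
      have "((m + l) mod n + n - l) mod n = ((m + l) mod n + (n - l)) mod n" using l by simp
      also have "\<dots> = (m + l + (n - l)) mod n" by (rule mod_add_left_eq)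
      finally show ?thesis using that l by simp
    qed
    have "(\<Sum>t<n. of_real (b ((t + n - l) mod n)) * twiddle n k t) =
        (\<Sum>m<n. of_real (b m) * twiddle n k ((m + l) mod n))"
      by (rule sum.reindex_bij_witness[of _ "\<lambda>m. (m + l) mod n" "\<lambda>t. (t + n - l) mod n"])
        (use n inv1 inv2 in auto)
    also have "\<dots> = twiddle n k l * (\<Sum>m<n. of_real (b m) * twiddle n k m)"
      using n by (simp add: twiddle_mod twiddle_add sum_distrib_left mult_ac)
    finally show "(\<Sum>t<n. of_real (a l) * (of_real (b ((t + n - l) mod n)) * twiddle n k t)) =
        of_real (a l) * twiddle n k l * (\<Sum>m<n. of_real (b m) * twiddle n k m)"
      by (simp flip: sum_distrib_left add: mult.assoc)
  qed
  finally show ?thesis by (simp add: sum_distrib_right)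
qed

lemma slice_tprod:
  assumes "0 < n"
  shows "slice n (tprod p n B C) k = mmul p (slice n B k) (slice n C k)"
proof (intro ext)
  fix i j
  have "slice n (tprod p n B C) k i j = (\<Sum>l<n. \<Sum>q<p. of_real (circ_conv n (B i q) (C q j) l) * twiddle n k l)"
    by (simp add: slice_eq tprod_def sum_distrib_right)
  also have "\<dots> = (\<Sum>q<p. \<Sum>l<n. of_real (circ_conv n (B i q) (C q j) l) * twiddle n k l)"
    by (rule sum.swap)
  finally show "slice n (tprod p n B C) k i j = mmul p (slice n B k) (slice n C k) i j"
    using assms by (simp add: slice_circ_conv mmul_def slice_eq)
qed

text \<open>Reversing a real tube conjugates its transform, so the tensor transpose becomes a
  slicewise adjoint.\<close>

lemma slice_ttranspose:
  assumes "0 < n"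
  shows "slice n (ttranspose n X) k = adj (slice n X k)"
proof (intro ext)
  fix i j
  have "slice n (ttranspose n X) k i j = (\<Sum>l<n. of_real (X j i (refl_idx n l)) * twiddle n k l)"
    by (auto simp: slice_eq ttranspose_def refl_idx_def intro!: sum.cong)
  also have "\<dots> = (\<Sum>l<n. of_real (X j i l) * twiddle n k (refl_idx n l))"
    by (rule sum.reindex_bij_witness[of _ "refl_idx n" "refl_idx n"])
      (use assms in \<open>auto simp: refl_idx_refl_idx refl_idx_less\<close>)
  also have "\<dots> = adj (slice n X k) i j"
    using assms by (simp add: twiddle_refl adj_def slice_eq)
  finally show "slice n (ttranspose n X) k i j = adj (slice n X k) i j" .
qed

lemma slice_tident:
  assumes "0 < n"
  shows "slice n (tident m n) k = idm m"
proof (intro ext)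
  fix i j
  have "slice n (tident m n) k i j = (\<Sum>l<n. if l = 0 then idm m i j else 0)"
    unfolding slice_eq by (rule sum.cong) (auto simp: tident_def idm_def twiddle_0)
  then show "slice n (tident m n) k i j = idm m i j" using assms by simp
qed

lemma slice_inversion:
  assumes "l < n"
  shows "(\<Sum>k<n. cnj (twiddle n k l) * slice n X k i j) = of_nat n * of_real (X i j l)"
proof -
  have "(\<Sum>k<n. cnj (twiddle n k l) * slice n X k i j) =
      (\<Sum>k<n. \<Sum>m<n. of_real (X i j m) * (cnj (twiddle n k l) * twiddle n k m))"
    by (simp add: slice_eq sum_distrib_left mult_ac)
  also have "\<dots> = (\<Sum>m<n. \<Sum>k<n. of_real (X i j m) * (cnj (twiddle n k l) * twiddle n k m))"
    by (rule sum.swap)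
  also have "\<dots> = (\<Sum>m<n. if m = l then of_real (X i j l) * of_nat n else 0)"
    using assms by (intro sum.cong refl) (auto simp: twiddle_orthogonal simp flip: sum_distrib_left)
  finally show ?thesis using assms by (simp add: mult.commute)
qed

lemma tensor_eqI:
  assumes "X \<in> tensors n1 n2 n" "Y \<in> tensors n1 n2 n" "\<And>k. k < n \<Longrightarrow> slice n X k = slice n Y k"
  shows "X = Y"
proof (intro ext)
  fix i j l
  show "X i j l = Y i j l"
  proof (cases "l < n")
    case True
    have "complex_of_nat n * of_real (X i j l) = of_nat n * of_real (Y i j l)"
      using assms(3) by (simp flip: slice_inversion[OF True])
    then show ?thesis using True by simp
  next
    case False
    then show ?thesis using assms(1,2) by (simp add: tensors_def)
  qed
qed

lemma parseval_tube:
  "(\<Sum>k<n. (cmod (slice n X k i j))\<^sup>2) = real n * (\<Sum>l<n. (X i j l)\<^sup>2)"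
proof -
  have "complex_of_real (\<Sum>k<n. (cmod (slice n X k i j))\<^sup>2) = (\<Sum>k<n. cnj (slice n X k i j) * slice n X k i j)"
    by (simp add: complex_norm_square mult.commute flip: of_real_power)
  also have "\<dots> = (\<Sum>k<n. \<Sum>l<n. of_real (X i j l) * (cnj (twiddle n k l) * slice n X k i j))"
    by (simp add: slice_eq[of n X _ i j, THEN arg_cong[where f = cnj]] sum_distrib_right mult.assoc)
  also have "\<dots> = (\<Sum>l<n. \<Sum>k<n. of_real (X i j l) * (cnj (twiddle n k l) * slice n X k i j))"
    by (rule sum.swap)
  also have "\<dots> = (\<Sum>l<n. of_real (X i j l) * (of_nat n * of_real (X i j l)))"
    by (intro sum.cong refl) (simp flip: sum_distrib_left add: slice_inversion)
  also have "\<dots> = complex_of_real (real n * (\<Sum>l<n. (X i j l)\<^sup>2))"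
    by (simp add: sum_distrib_left power2_eq_square mult_ac)
  finally show ?thesis using of_real_eq_iff by blast
qed

lemma tinner_self_nonneg: "0 \<le> tinner n1 n2 n X X"
  by (simp add: tinner_def sum_nonneg)

lemma tnorm_sq: "(tnorm n1 n2 n X)\<^sup>2 = tinner n1 n2 n X X"
  by (simp add: tnorm_def tinner_self_nonneg)

lemma parseval: "real n * (tnorm n1 n2 n X)\<^sup>2 = (\<Sum>k<n. fro n1 n2 (slice n X k))"
proof -
  have "(\<Sum>k<n. fro n1 n2 (slice n X k)) = (\<Sum>i<n1. \<Sum>k<n. \<Sum>j<n2. (cmod (slice n X k i j))\<^sup>2)"
    unfolding fro_def by (rule sum.swap)
  also have "\<dots> = (\<Sum>i<n1. \<Sum>j<n2. \<Sum>k<n. (cmod (slice n X k i j))\<^sup>2)"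
    by (intro sum.cong refl sum.swap)
  also have "\<dots> = real n * tinner n1 n2 n X X"
    unfolding parseval_tube by (simp add: tinner_def sum_distrib_left power2_eq_square)
  finally show ?thesis by (simp add: tnorm_sq)
qed

text \<open>The inverse transform. \<open>Re\<close> forces a real tensor and loses nothing when
  mirrored slices are conjugate, which is the hypothesis of \<open>slice_inv_slices\<close>.\<close>

definition inv_slices :: "nat \<Rightarrow> (nat \<Rightarrow> cmat) \<Rightarrow> tensor" where
  "inv_slices n W = (\<lambda>i j l. if l < n then Re ((\<Sum>k<n. W k i j * cnj (twiddle n k l)) / of_nat n) else 0)"

lemma slice_inv_slices:
  assumes W: "\<And>k. k < n \<Longrightarrow> W (refl_idx n k) = mconj (W k)" and k: "k < n"
  shows "slice n (inv_slices n W) k = W k"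
proof (intro ext)
  fix i j
  define c where "c l = (\<Sum>k<n. W k i j * cnj (twiddle n k l))" for l
  have n: "0 < n" using k by simp
  \<comment> \<open>Mirroring the summation index turns \<open>c l\<close> into its own
    conjugate.\<close>
  have real: "complex_of_real (Re (c l / of_nat n)) = c l / of_nat n" for l
  proof -
    have "c l = (\<Sum>k<n. W (refl_idx n k) i j * cnj (twiddle n (refl_idx n k) l))"
      unfolding c_def by (rule sum.reindex_bij_witness[of _ "refl_idx n" "refl_idx n"])
        (use n in \<open>auto simp: refl_idx_refl_idx refl_idx_less\<close>)
    also have "\<dots> = cnj (c l)"
      using n by (simp add: c_def W mconj_def twiddle_commute[of n _ l] twiddle_refl)
    finally have "c l \<in> \<real>" by (simp add: Reals_cnj_iff)
    then have "c l / of_nat n \<in> \<real>" by simp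
    then show ?thesis by (rule of_real_Re)
  qed
  have "slice n (inv_slices n W) k i j = (\<Sum>l<n. c l / of_nat n * twiddle n k l)"
    unfolding slice_eq
  proof (rule sum.cong[OF refl])
    fix l assume "l \<in> {..<n}"
    then have "inv_slices n W i j l = Re (c l / of_nat n)" by (simp add: inv_slices_def c_def)
    then show "of_real (inv_slices n W i j l) * twiddle n k l = c l / of_nat n * twiddle n k l"
      by (simp only: real)
  qed
  also have "\<dots> = (\<Sum>l<n. \<Sum>m<n. W m i j / of_nat n * (cnj (twiddle n l m) * twiddle n l k))"
  proof (rule sum.cong[OF refl])
    fix l
    have "c l = (\<Sum>m<n. W m i j * cnj (twiddle n l m))"
      unfolding c_def by (rule sum.cong[OF refl]) (subst twiddle_commute, rule refl)
    then show "c l / of_nat n * twiddle n k l = (\<Sum>m<n. W m i j / of_nat n * (cnj (twiddle n l m) * twiddle n l k))"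
      by (simp add: sum_divide_distrib sum_distrib_right twiddle_commute[of n k l] mult.assoc)
  qed
  also have "\<dots> = (\<Sum>m<n. \<Sum>l<n. W m i j / of_nat n * (cnj (twiddle n l m) * twiddle n l k))"
    by (rule sum.swap)
  also have "\<dots> = (\<Sum>m<n. if m = k then W k i j else 0)"
    unfolding sum_distrib_left[symmetric] using k n by (intro sum.cong refl) (auto simp: twiddle_orthogonal)
  finally show "slice n (inv_slices n W) k i j = W k i j" using k by simp
qed

lemma inv_slices_in_tensors:
  assumes "\<And>k. k < n \<Longrightarrow> supp n1 n2 (W k)"
  shows "inv_slices n W \<in> tensors n1 n2 n"
  using assms by (auto simp: tensors_def inv_slices_def supp_def)

lemma supp_slice: "X \<in> tensors n1 n2 n \<Longrightarrow> supp n1 n2 (slice n X k)"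
  by (auto simp: supp_def tensors_def slice_eq)

lemma circ_conv_zero: "circ_conv n (\<lambda>_. 0) b = (\<lambda>_. 0)" "circ_conv n a (\<lambda>_. 0) = (\<lambda>_. 0)"
  by (auto simp: circ_conv_def)

lemma tprod_in_tensors:
  assumes "B \<in> tensors n1 p n" "C \<in> tensors p n2 n"
  shows "tprod p n B C \<in> tensors n1 n2 n"
proof -
  have "tprod p n B C i j l = 0" if out: "\<not> (i < n1 \<and> j < n2 \<and> l < n)" for i j l
  proof -
    consider "\<not> i < n1" | "\<not> j < n2" | "\<not> l < n" using out by blast
    then show ?thesis
    proof cases
      case 1
      then have "B i q = (\<lambda>_. 0)" for q using assms by (auto simp: tensors_def)
      then show ?thesis by (simp add: tprod_def circ_conv_zero)
    next
      case 2
      then have "C q j = (\<lambda>_. 0)" for q using assms by (auto simp: tensors_def)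
      then show ?thesis by (simp add: tprod_def circ_conv_zero)
    next
      case 3
      then show ?thesis by (simp add: tprod_def circ_conv_def)
    qed
  qed
  then show ?thesis by (simp add: tensors_def)
qed

lemma ttranspose_in_tensors: "X \<in> tensors n1 n2 n \<Longrightarrow> ttranspose n X \<in> tensors n2 n1 n"
  by (auto simp: tensors_def ttranspose_def)

lemma tident_in_tensors: "tident m n \<in> tensors m m n"
  by (auto simp: tensors_def tident_def)

section \<open>Correspondence between t-SVDs and slicewise SVDs\<close>

lemma torthogonal_iff:
  assumes n: "0 < n" and Q: "Q \<in> tensors m m n"
  shows "torthogonal m n Q \<longleftrightarrow> (\<forall>k<n. unitary m (slice n Q k))"
proof
  assume "torthogonal m n Q"
  then have e: "tprod m n Q (ttranspose n Q) = tident m n" "tprod m n (ttranspose n Q) Q = tident m n"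
    by (auto simp: torthogonal_def)
  show "\<forall>k<n. unitary m (slice n Q k)"
    using e[THEN arg_cong[where f = "slice n"]] n
    by (auto simp: unitary_def supp_slice[OF Q] slice_tprod slice_ttranspose slice_tident fun_eq_iff[of "slice n _"])
next
  assume u: "\<forall>k<n. unitary m (slice n Q k)"
  have "tprod m n Q (ttranspose n Q) = tident m n"
    by (rule tensor_eqI[OF tprod_in_tensors[OF Q ttranspose_in_tensors[OF Q]] tident_in_tensors])
      (use u n in \<open>simp add: unitary_def slice_tprod slice_ttranspose slice_tident\<close>)
  moreover have "tprod m n (ttranspose n Q) Q = tident m n"
    by (rule tensor_eqI[OF tprod_in_tensors[OF ttranspose_in_tensors[OF Q] Q] tident_in_tensors])
      (use u n in \<open>simp add: unitary_def slice_tprod slice_ttranspose slice_tident\<close>)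
  ultimately show "torthogonal m n Q" using Q by (simp add: torthogonal_def)
qed

lemma is_tsvd_slices:
  assumes n: "0 < n" and svd: "is_tsvd n1 n2 n X U S V" and k: "k < n"
  shows "is_svd n1 n2 (slice n X k) (slice n U k) (slice n S k) (slice n V k)"
proof -
  have U: "U \<in> tensors n1 n1 n" and V: "V \<in> tensors n2 n2 n" and S: "S \<in> tensors n1 n2 n"
    using svd by (auto simp: is_tsvd_def torthogonal_def)
  have X: "X = tprod n2 n (tprod n1 n U S) (ttranspose n V)" using svd by (simp add: is_tsvd_def)
  have "slice n S k i j = 0" if "i \<noteq> j" for i j
    using svd that by (simp add: is_tsvd_def f_diagonal_def slice_eq)
  moreover have "unitary n1 (slice n U k)" "unitary n2 (slice n V k)"
    using svd k torthogonal_iff[OF n U] torthogonal_iff[OF n V] by (auto simp: is_tsvd_def)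
  moreover have "slice n X k = mmul n2 (mmul n1 (slice n U k) (slice n S k)) (adj (slice n V k))"
    using n by (simp add: X slice_tprod slice_ttranspose)
  ultimately show ?thesis
    using svd k supp_slice[OF S] unfolding is_svd_def is_tsvd_def by (simp add: slice_def)
qed

lemma is_tsvdI:
  assumes n: "0 < n" and X: "X \<in> tensors n1 n2 n"
    and U: "U \<in> tensors n1 n1 n" and S: "S \<in> tensors n1 n2 n" and V: "V \<in> tensors n2 n2 n"
    and svd: "\<And>k. k < n \<Longrightarrow> is_svd n1 n2 (slice n X k) (slice n U k) (slice n S k) (slice n V k)"
  shows "is_tsvd n1 n2 n X U S V"
proof -
  have "S i j l = 0" if "i \<noteq> j" for i j l
  proof (cases "l < n")
    case True
    have "slice n S k i j = 0" if "k < n" for k using svd[OF that] \<open>i \<noteq> j\<close> by (simp add: is_svd_def)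
    then show ?thesis using slice_inversion[OF True, of S i j] n by simp
  next
    case False
    then show ?thesis using S by (simp add: tensors_def)
  qed
  moreover have "X = tprod n2 n (tprod n1 n U S) (ttranspose n V)"
    by (rule tensor_eqI[OF X tprod_in_tensors[OF tprod_in_tensors[OF U S] ttranspose_in_tensors[OF V]]])
      (use n svd in \<open>simp add: slice_tprod slice_ttranspose is_svd_def\<close>)
  ultimately show ?thesis
    using svd S torthogonal_iff[OF n U] torthogonal_iff[OF n V]
    unfolding is_tsvd_def is_svd_def f_diagonal_def by (simp add: slice_def)
qed

lemma mconj_mmul: "mconj (mmul n A B) = mmul n (mconj A) (mconj B)"
  by (simp add: mconj_def mmul_def)

lemma mconj_adj: "mconj (adj A) = adj (mconj A)"
  by (simp add: mconj_def adj_def)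

lemma mconj_mconj: "mconj (mconj A) = A"
  by (simp add: mconj_def)

lemma mconj_idm: "mconj (idm n) = idm n"
  by (auto simp: mconj_def idm_def fun_eq_iff)

lemma mconj_eq: "(\<And>i j. A i j \<in> \<real>) \<Longrightarrow> mconj A = A"
  by (simp add: mconj_def Reals_cnj_iff)

lemma unitary_mconj: "unitary n U \<Longrightarrow> unitary n (mconj U)"
  unfolding unitary_def
  by (simp add: mconj_adj[symmetric] mconj_mmul[symmetric] mconj_idm) (simp add: supp_def mconj_def)

lemma is_svd_real_middle: "is_svd n1 n2 M U S V \<Longrightarrow> mconj S = S"
proof (intro mconj_eq)
  fix i j assume svd: "is_svd n1 n2 M U S V"
  show "S i j \<in> \<real>"
  proof (cases "i = j \<and> i < min n1 n2")
    case True
    then show ?thesis using svd by (simp add: is_svd_def complex_is_Real_iff)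
  next
    case False
    then have "S i j = 0" using svd by (auto simp: is_svd_def supp_def)
    then show ?thesis by simp
  qed
qed

text \<open>The middle factor is real, so conjugation leaves it alone: mirrored slices share their
  singular values.\<close>

lemma is_svd_mconj: "is_svd n1 n2 M U S V \<Longrightarrow> is_svd n1 n2 (mconj M) (mconj U) S (mconj V)"
  using is_svd_real_middle[of n1 n2 M U S V]
  by (auto simp: is_svd_def unitary_mconj mconj_mmul mconj_adj)

text \<open>Conjugating the decomposition of the slice \<open>k\<close> decomposes the mirrored slice \<open>n - k\<close>. Choosing
  mirrored factors, real ones for the self-mirrored slices, makes the factor tensors real.\<close>

lemma tsvd_exists:
  assumes n: "0 < n" and X: "X \<in> tensors n1 n2 n"
  shows "\<exists>U S V. is_tsvd n1 n2 n X U S V"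
proof -
  have "\<exists>U S V. is_svd n1 n2 (slice n X k) U S V \<and>
      (refl_idx n k = k \<longrightarrow> mconj U = U \<and> mconj V = V)" if "k < n" for k
  proof (cases "refl_idx n k = k")
    case True
    interpret real_or_complex "\<real>" by standard simp
    have "mconj (slice n X k) = slice n X k" using slice_refl[OF that] True by simp
    then have "cnj (slice n X k i j) = slice n X k i j" for i j by (simp add: mconj_def fun_eq_iff)
    then have "slice n X k i j \<in> \<real>" for i j by (simp add: Reals_cnj_iff)
    then show ?thesis using svd_exists[OF supp_slice[OF X]] mconj_eq by meson
  next
    case False
    interpret real_or_complex UNIV by standard simp
    show ?thesis using svd_exists[OF supp_slice[OF X]] False by (meson UNIV_I)
  qed
  then obtain U S V where svd: "\<And>k. k < n \<Longrightarrow> is_svd n1 n2 (slice n X k) (U k) (S k) (V k)"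
    and self: "\<And>k. k < n \<Longrightarrow> refl_idx n k = k \<Longrightarrow> mconj (U k) = U k \<and> mconj (V k) = V k"
    by metis
  define mirror where "mirror W k = (if k \<le> refl_idx n k then W k else mconj (W (refl_idx n k)))" for W :: "nat \<Rightarrow> cmat" and k
  have mirror: "mirror W (refl_idx n k) = mconj (mirror W k)"
    if "k < n" "\<And>k. k < n \<Longrightarrow> refl_idx n k = k \<Longrightarrow> mconj (W k) = W k" for W k
    using that refl_idx_refl_idx[OF that(1)] refl_idx_less[OF n, of k]
    by (cases k "refl_idx n k" rule: linorder_cases) (auto simp: mirror_def mconj_mconj)
  have svd': "is_svd n1 n2 (slice n X k) (mirror U k) (mirror S k) (mirror V k)" if k: "k < n" for k
  proof (cases "k \<le> refl_idx n k")
    case True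
    then show ?thesis using svd[OF k] by (simp add: mirror_def)
  next
    case False
    have r: "refl_idx n k < n" using n by (rule refl_idx_less)
    have "slice n X k = mconj (slice n X (refl_idx n k))" using k by (simp add: slice_refl mconj_mconj)
    then show ?thesis
      using False is_svd_mconj[OF svd[OF r]] is_svd_real_middle[OF svd[OF r]] by (simp add: mirror_def)
  qed
  have sl: "slice n (inv_slices n (mirror U)) k = mirror U k" "slice n (inv_slices n (mirror S)) k = mirror S k"
    "slice n (inv_slices n (mirror V)) k = mirror V k" if "k < n" for k
    using that mirror self is_svd_real_middle[OF svd] by (auto intro!: slice_inv_slices)
  have "is_tsvd n1 n2 n X (inv_slices n (mirror U)) (inv_slices n (mirror S)) (inv_slices n (mirror V))"
  proof (rule is_tsvdI[OF n X])
    show "inv_slices n (mirror U) \<in> tensors n1 n1 n" "inv_slices n (mirror S) \<in> tensors n1 n2 n"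
      "inv_slices n (mirror V) \<in> tensors n2 n2 n"
      using svd' by (auto intro!: inv_slices_in_tensors simp: is_svd_def unitary_def)
  qed (simp add: sl svd')
  then show ?thesis by blast
qed

section \<open>Tubal rank and hard thresholding\<close>

text \<open>Slice rank expressed by a factorization, a form that adds under sums and needs no outer
  dimensions.\<close>

definition slices_rank_le :: "nat \<Rightarrow> nat \<Rightarrow> tensor \<Rightarrow> bool" where
  "slices_rank_le s n X \<longleftrightarrow> (\<forall>k<n. \<exists>A B. slice n X k = mmul s A B)"

text \<open>Each slice has its column space within the first \<open>r\<close> columns of a unitary
  matrix, the shape required of a competitor in \<open>eckart_young\<close>.\<close>

definition slices_orth_rank_le :: "nat \<Rightarrow> nat \<Rightarrow> nat \<Rightarrow> tensor \<Rightarrow> bool" where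
  "slices_orth_rank_le n1 r n X \<longleftrightarrow>
    (\<forall>k<n. \<exists>P G. unitary n1 P \<and> (\<forall>p j. r \<le> p \<longrightarrow> G p j = 0) \<and> slice n X k = mmul n1 P G)"

lemma slices_rank_le_if_orth:
  "slices_orth_rank_le n1 r n X \<Longrightarrow> r \<le> n1 \<Longrightarrow> slices_rank_le r n X"
  unfolding slices_orth_rank_le_def slices_rank_le_def by (metis mmul_restrict_rows)

lemma slice_combination:
  "slice n (\<lambda>i j l. a * X i j l + b * Y i j l) k = (\<lambda>i j. of_real a * slice n X k i j + of_real b * slice n Y k i j)"
  by (simp add: fun_eq_iff slice_eq sum.distrib sum_distrib_left ring_distribs mult.assoc)

lemma slice_diff: "slice n (\<lambda>i j l. X i j l - Y i j l) k = (\<lambda>i j. slice n X k i j - slice n Y k i j)"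
  using slice_combination[of n 1 X "- 1" Y k] by simp

lemma slices_rank_le_combination:
  assumes "slices_rank_le s n X" "slices_rank_le t n Y"
  shows "slices_rank_le (s + t) n (\<lambda>i j l. a * X i j l + b * Y i j l)"
  unfolding slices_rank_le_def
proof (intro allI impI)
  fix k assume "k < n"
  then obtain A B C D where f: "slice n X k = mmul s A B" "slice n Y k = mmul t C D"
    using assms unfolding slices_rank_le_def by meson
  have "slice n (\<lambda>i j l. a * X i j l + b * Y i j l) k =
      (\<lambda>i j. mmul s (\<lambda>i p. of_real a * A i p) B i j + mmul t (\<lambda>i p. of_real b * C i p) D i j)"
    unfolding slice_combination f by (simp add: mmul_def sum_distrib_left mult.assoc)
  then show "\<exists>A B. slice n (\<lambda>i j l. a * X i j l + b * Y i j l) k = mmul (s + t) A B"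
    unfolding mmul_add_factors by blast
qed

text \<open>Existence of a t-SVD guarantees that the \<open>SOME\<close> in
  \<open>tubal_rank\<close> really selects one, so its properties become available.\<close>

lemma tubal_rank_witness:
  assumes "0 < n" "X \<in> tensors n1 n2 n"
  shows "\<exists>U S V. is_tsvd n1 n2 n X U S V \<and>
    tubal_rank n1 n2 n X = card {i. i < min n1 n2 \<and> (\<exists>k<n. S i i k \<noteq> 0)}"
proof -
  define S where "S = (SOME S. \<exists>U V. is_tsvd n1 n2 n X U S V)"
  have "\<exists>S. \<exists>U V. is_tsvd n1 n2 n X U S V" using tsvd_exists[OF assms] by blast
  then have "\<exists>U V. is_tsvd n1 n2 n X U S V" unfolding S_def by (rule someI_ex)
  then show ?thesis unfolding tubal_rank_def by (auto simp: S_def Let_def)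
qed

text \<open>The factorizations kill the singular values from index \<open>s\<close> on in every
  slice; by inversion the corresponding tubes vanish.\<close>

lemma tubal_rank_le:
  assumes n: "0 < n" and X: "X \<in> tensors n1 n2 n" and rk: "slices_rank_le s n X"
  shows "tubal_rank n1 n2 n X \<le> s"
proof -
  obtain U S V where svd: "is_tsvd n1 n2 n X U S V"
    and tr: "tubal_rank n1 n2 n X = card {i. i < min n1 n2 \<and> (\<exists>k<n. S i i k \<noteq> 0)}"
    using tubal_rank_witness[OF n X] by blast
  have "S i i l = 0" if i: "s \<le> i" "i < min n1 n2" and l: "l < n" for i l
  proof -
    have "slice n S k i i = 0" if "k < n" for k
      using svd_rank_bound[OF is_tsvd_slices[OF n svd that]] rk that i
      unfolding slices_rank_le_def by blast
    then show ?thesis using slice_inversion[OF l, of S i i] n by simp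
  qed
  then have "{i. i < min n1 n2 \<and> (\<exists>k<n. S i i k \<noteq> 0)} \<subseteq> {..<s}" by (auto simp: not_le[symmetric])
  then have "card {i. i < min n1 n2 \<and> (\<exists>k<n. S i i k \<noteq> 0)} \<le> card {..<s}" by (intro card_mono) auto
  then show ?thesis using tr by simp
qed

text \<open>The rank counts tubes, whereas a slice needs a bound on indices. A positive singular
  value at index \<open>i\<close> makes, by the ordering within its slice, all tubes up to
  \<open>i\<close> nonzero, so the count is at least \<open>i + 1\<close>.\<close>

lemma slices_orth_rank_le_if_tubal_rank:
  assumes n: "0 < n" and X: "X \<in> tensors n1 n2 n" and tr: "tubal_rank n1 n2 n X \<le> r"
  shows "slices_orth_rank_le n1 r n X"
  unfolding slices_orth_rank_le_def
proof (intro allI impI)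
  fix k assume k: "k < n"
  obtain U S V where svd: "is_tsvd n1 n2 n X U S V"
    and card: "card {i. i < min n1 n2 \<and> (\<exists>k<n. S i i k \<noteq> 0)} \<le> r"
    using tubal_rank_witness[OF n X] tr by auto
  have sv: "is_svd n1 n2 (slice n X k) (slice n U k) (slice n S k) (slice n V k)"
    by (rule is_tsvd_slices[OF n svd k])
  have z: "slice n S k i i = 0" if i: "r \<le> i" "i < min n1 n2" for i
  proof (rule ccontr)
    assume "slice n S k i i \<noteq> 0"
    moreover have "Im (slice n S k i i) = 0" "0 \<le> Re (slice n S k i i)"
      using sv i by (auto simp: is_svd_def)
    ultimately have pos: "0 < Re (slice n S k i i)"
      by (metis complex_eq_iff less_eq_real_def zero_complex.simps)
    have "\<exists>l<n. S p p l \<noteq> 0" if "p \<le> i" for p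
    proof (rule ccontr)
      assume "\<not> ?thesis"
      then have "slice n S k p p = 0" by (simp add: slice_eq)
      moreover have "Re (slice n S k i i) \<le> Re (slice n S k p p)"
        using sv i that by (auto simp: is_svd_def)
      ultimately show False using pos by simp
    qed
    then have "{..i} \<subseteq> {i. i < min n1 n2 \<and> (\<exists>k<n. S i i k \<noteq> 0)}" using i by auto
    then have "card {..i} \<le> card {i. i < min n1 n2 \<and> (\<exists>k<n. S i i k \<noteq> 0)}" by (intro card_mono) auto
    then show False using card i by simp
  qed
  define G where "G = mmul n2 (slice n S k) (adj (slice n V k))"
  have "slice n S k p q = 0" if "r \<le> p" for p q
    using z[OF that] sv by (cases "p = q \<and> p < min n1 n2") (auto simp: is_svd_def supp_def)
  then have "\<forall>p j. r \<le> p \<longrightarrow> G p j = 0" by (simp add: G_def mmul_def)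
  moreover have "slice n X k = mmul n1 (slice n U k) G"
    using sv by (simp add: is_svd_def G_def mmul_assoc)
  ultimately show "\<exists>P G. unitary n1 P \<and> (\<forall>p j. r \<le> p \<longrightarrow> G p j = 0) \<and> slice n X k = mmul n1 P G"
    using sv unfolding is_svd_def by blast
qed

lemma hard_threshold_properties:
  assumes n: "0 < n" and r: "r \<le> min n1 n2" and H: "H \<in> tube_hard_thresholds n1 n2 n r Z"
  shows "H \<in> tensors n1 n2 n" and "slices_orth_rank_le n1 r n H"
    and "slices_orth_rank_le n1 r n Y \<Longrightarrow>
      tnorm n1 n2 n (\<lambda>i j k. Z i j k - H i j k) \<le> tnorm n1 n2 n (\<lambda>i j k. Z i j k - Y i j k)"
proof -
  obtain U S V where svd: "is_tsvd n1 n2 n Z U S V"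
    and H: "H = tprod n2 n (tprod n1 n U (truncate_tubes r S)) (ttranspose n V)"
    using H unfolding tube_hard_thresholds_def by blast
  have U: "U \<in> tensors n1 n1 n" and V: "V \<in> tensors n2 n2 n" and S: "S \<in> tensors n1 n2 n"
    using svd by (auto simp: is_tsvd_def torthogonal_def)
  have T: "truncate_tubes r S \<in> tensors n1 n2 n"
    using S by (auto simp: tensors_def truncate_tubes_def)
  show "H \<in> tensors n1 n2 n"
    unfolding H by (intro tprod_in_tensors ttranspose_in_tensors U V T)
  \<comment> \<open>Truncation zeroes whole tubes, hence commutes with the transform along
    tubes.\<close>
  have sT: "slice n (truncate_tubes r S) k = (\<lambda>i j. if i = j \<and> r \<le> i then 0 else slice n S k i j)" for k
    by (auto simp: slice_eq truncate_tubes_def fun_eq_iff intro!: sum.cong)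
  have sH: "slice n H k = mmul n2 (mmul n1 (slice n U k)
      (\<lambda>i j. if i = j \<and> r \<le> i then 0 else slice n S k i j)) (adj (slice n V k))" for k
    using n by (simp add: H slice_tprod slice_ttranspose sT)
  show "slices_orth_rank_le n1 r n H"
    unfolding slices_orth_rank_le_def
  proof (intro allI impI)
    fix k assume "k < n"
    then have sv: "is_svd n1 n2 (slice n Z k) (slice n U k) (slice n S k) (slice n V k)"
      by (rule is_tsvd_slices[OF n svd])
    define G where "G = mmul n2 (\<lambda>i j. if i = j \<and> r \<le> i then 0 else slice n S k i j) (adj (slice n V k))"
    have "G p j = 0" if "r \<le> p" for p j
      using sv that by (auto simp: G_def mmul_def is_svd_def intro!: sum.neutral)
    moreover have "slice n H k = mmul n1 (slice n U k) G"
      by (simp add: sH G_def mmul_assoc)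
    ultimately show "\<exists>P G. unitary n1 P \<and> (\<forall>p j. r \<le> p \<longrightarrow> G p j = 0) \<and> slice n H k = mmul n1 P G"
      using sv unfolding is_svd_def by blast
  qed
  assume Y: "slices_orth_rank_le n1 r n Y"
  have "fro n1 n2 (slice n (\<lambda>i j l. Z i j l - H i j l) k) \<le> fro n1 n2 (slice n (\<lambda>i j l. Z i j l - Y i j l) k)"
    if k: "k < n" for k
  proof -
    obtain P G where PG: "unitary n1 P" "\<And>p j. r \<le> p \<Longrightarrow> G p j = 0" "slice n Y k = mmul n1 P G"
      using Y k unfolding slices_orth_rank_le_def by blast
    show ?thesis
      unfolding slice_diff sH PG(3)
      by (rule eckart_young[OF is_tsvd_slices[OF n svd k] r PG(1)]) (rule PG(2))
  qed
  then have "real n * (tnorm n1 n2 n (\<lambda>i j k. Z i j k - H i j k))\<^sup>2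
      \<le> real n * (tnorm n1 n2 n (\<lambda>i j k. Z i j k - Y i j k))\<^sup>2"
    unfolding parseval by (intro sum_mono) simp
  then have "(tnorm n1 n2 n (\<lambda>i j k. Z i j k - H i j k))\<^sup>2
      \<le> (tnorm n1 n2 n (\<lambda>i j k. Z i j k - Y i j k))\<^sup>2"
    using n by simp
  then show "tnorm n1 n2 n (\<lambda>i j k. Z i j k - H i j k) \<le> tnorm n1 n2 n (\<lambda>i j k. Z i j k - Y i j k)"
    by (rule power2_le_imp_le) (simp add: tnorm_def tinner_self_nonneg)
qed

section \<open>Linear maps on tensors and the least-squares gradient\<close>

lemma tensors_combination:
  "X \<in> tensors n1 n2 n \<Longrightarrow> Y \<in> tensors n1 n2 n \<Longrightarrow> (\<lambda>i j k. a * X i j k + b * Y i j k) \<in> tensors n1 n2 n"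
  by (simp add: tensors_def)

lemma tensors_scale: "X \<in> tensors n1 n2 n \<Longrightarrow> (\<lambda>i j k. a * X i j k) \<in> tensors n1 n2 n"
  by (simp add: tensors_def)

lemma tensors_diff:
  "X \<in> tensors n1 n2 n \<Longrightarrow> Y \<in> tensors n1 n2 n \<Longrightarrow> (\<lambda>i j k. X i j k - Y i j k) \<in> tensors n1 n2 n"
  by (simp add: tensors_def)

lemma tlinear_combination:
  assumes A: "tlinear n1 n2 n A" and X: "X \<in> tensors n1 n2 n" and Y: "Y \<in> tensors n1 n2 n"
  shows "A (\<lambda>i j k. a * X i j k + b * Y i j k) = a *\<^sub>R A X + b *\<^sub>R A Y"
proof -
  have "A (\<lambda>i j k. a * X i j k + b * Y i j k) = A (\<lambda>i j k. a * X i j k) + A (\<lambda>i j k. b * Y i j k)"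
    using A tensors_scale[OF X, of a] tensors_scale[OF Y, of b] unfolding tlinear_def by fast
  then show ?thesis using A X Y unfolding tlinear_def by simp
qed

lemma tlinear_diff:
  assumes "tlinear n1 n2 n A" "X \<in> tensors n1 n2 n" "Y \<in> tensors n1 n2 n"
  shows "A (\<lambda>i j k. X i j k - Y i j k) = A X - A Y"
  using tlinear_combination[OF assms, of 1 "- 1"] by simp

lemma tlinear_sum:
  assumes A: "tlinear n1 n2 n A" and B: "\<And>p. p \<in> P \<Longrightarrow> B p \<in> tensors n1 n2 n" and P: "finite P"
  shows "A (\<lambda>i j k. \<Sum>p\<in>P. c p * B p i j k) = (\<Sum>p\<in>P. c p *\<^sub>R A (B p))"
  using P B
proof (induction P rule: finite_induct)
  case empty
  have "(\<lambda>i j k. 0) \<in> tensors n1 n2 n" by (simp add: tensors_def)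
  then have "A (\<lambda>i j k. 0 * 0) = 0 *\<^sub>R A (\<lambda>i j k. 0)" using A unfolding tlinear_def by fast
  then show ?case by simp
next
  case (insert p P)
  have "(\<lambda>i j k. \<Sum>p\<in>P. c p * B p i j k) \<in> tensors n1 n2 n"
    using insert.prems by (simp add: tensors_def)
  then have "A (\<lambda>i j k. c p * B p i j k + 1 * (\<Sum>p\<in>P. c p * B p i j k))
      = c p *\<^sub>R A (B p) + 1 *\<^sub>R A (\<lambda>i j k. \<Sum>p\<in>P. c p * B p i j k)"
    using insert.prems by (intro tlinear_combination[OF A]) auto
  then show ?case using insert by simp
qed

definition unit_tensor :: "nat \<times> nat \<times> nat \<Rightarrow> tensor" where
  "unit_tensor p = (\<lambda>i j k. if (i, j, k) = p then 1 else 0)"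

definition tensor_box :: "nat \<Rightarrow> nat \<Rightarrow> nat \<Rightarrow> (nat \<times> nat \<times> nat) set" where
  "tensor_box n1 n2 n = {..<n1} \<times> {..<n2} \<times> {..<n}"

lemma unit_tensor_in_tensors: "p \<in> tensor_box n1 n2 n \<Longrightarrow> unit_tensor p \<in> tensors n1 n2 n"
  by (auto simp: unit_tensor_def tensor_box_def tensors_def)

lemma tinner_tensor_box: "tinner n1 n2 n X Y = (\<Sum>(i, j, k)\<in>tensor_box n1 n2 n. X i j k * Y i j k)"
  by (simp add: tinner_def tensor_box_def sum.cartesian_product)

lemma tlinear_expand:
  assumes A: "tlinear n1 n2 n A" and X: "X \<in> tensors n1 n2 n"
  shows "A X = (\<Sum>(i, j, k)\<in>tensor_box n1 n2 n. X i j k *\<^sub>R A (unit_tensor (i, j, k)))"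
proof -
  have *: "X i j k = (\<Sum>p\<in>tensor_box n1 n2 n. (case p of (i, j, k) \<Rightarrow> X i j k) * unit_tensor p i j k)" for i j k
  proof -
    have "(\<Sum>p\<in>tensor_box n1 n2 n. (case p of (i, j, k) \<Rightarrow> X i j k) * unit_tensor p i j k)
        = (\<Sum>p\<in>tensor_box n1 n2 n. if p = (i, j, k) then X i j k else 0)"
      by (intro sum.cong refl) (auto simp: unit_tensor_def)
    also have "\<dots> = X i j k" using X by (auto simp: tensor_box_def tensors_def)
    finally show ?thesis by simp
  qed
  have "A X = A (\<lambda>i j k. \<Sum>p\<in>tensor_box n1 n2 n. (case p of (i, j, k) \<Rightarrow> X i j k) * unit_tensor p i j k)"
    by (intro arg_cong[where f = A] ext *)
  also have "\<dots> = (\<Sum>p\<in>tensor_box n1 n2 n. (case p of (i, j, k) \<Rightarrow> X i j k) *\<^sub>R A (unit_tensor p))"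
    by (rule tlinear_sum[OF A unit_tensor_in_tensors]) (simp_all add: tensor_box_def)
  finally show ?thesis by (simp add: case_prod_unfold)
qed

text \<open>Changing a single entry adds a multiple of a unit tensor, so \<open>f\<close> is a
  quadratic polynomial along that entry and its derivative is the linear coefficient.\<close>

lemma tgrad_least_squares:
  fixes A :: "tensor \<Rightarrow> 'b::real_inner"
  assumes A: "tlinear n1 n2 n A" and f: "\<And>W. f W = 1 / 2 * (norm (A W - y))\<^sup>2"
    and X: "X \<in> tensors n1 n2 n" and p: "(i, j, k) \<in> tensor_box n1 n2 n"
  shows "tgrad n1 n2 n f X i j k = inner (A (unit_tensor (i, j, k))) (A X - y)"
proof -
  define b where "b = A (unit_tensor (i, j, k))"
  define a where "a = A X - y"
  define x where "x = X i j k"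
  have eq: "f (X(i := (X i)(j := (X i j)(k := h)))) = 1 / 2 * (inner a a + 2 * (h - x) * inner b a + (h - x)\<^sup>2 * inner b b)" for h
  proof -
    have "X(i := (X i)(j := (X i j)(k := h))) = (\<lambda>i' j' k'. 1 * X i' j' k' + (h - x) * unit_tensor (i, j, k) i' j' k')"
      by (auto simp: fun_eq_iff unit_tensor_def x_def)
    then have *: "A (X(i := (X i)(j := (X i j)(k := h)))) - y = a + (h - x) *\<^sub>R b"
      using tlinear_combination[OF A X unit_tensor_in_tensors[OF p], of 1 "h - x"]
      by (simp add: a_def b_def)
    show ?thesis
      unfolding f * power2_norm_eq_inner
      by (simp add: inner_add_left inner_add_right inner_commute[of a b] power2_eq_square algebra_simps)
  qed
  have D: "((\<lambda>h. 1 / 2 * (inner a a + 2 * (h - x) * inner b a + (h - x)\<^sup>2 * inner b b)) has_field_derivative inner b a) (at x)"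
    by (auto intro!: derivative_eq_intros)
  have "deriv (\<lambda>h. f (X(i := (X i)(j := (X i j)(k := h))))) x = inner b a"
    unfolding eq using D by (rule DERIV_imp_deriv)
  then show ?thesis using p by (simp add: tgrad_def tensor_box_def a_def b_def x_def)
qed

text \<open>The gradient is the adjoint of \<open>A\<close> applied to the residual; testing against
  \<open>W\<close> says this without introducing the adjoint.\<close>

lemma tinner_tgrad:
  fixes A :: "tensor \<Rightarrow> 'b::real_inner"
  assumes A: "tlinear n1 n2 n A" and f: "\<And>W. f W = 1 / 2 * (norm (A W - y))\<^sup>2"
    and X: "X \<in> tensors n1 n2 n" and W: "W \<in> tensors n1 n2 n"
  shows "tinner n1 n2 n W (tgrad n1 n2 n f X) = inner (A W) (A X - y)"
proof -
  have "inner (A W) (A X - y) = (\<Sum>(i, j, k)\<in>tensor_box n1 n2 n. W i j k * inner (A (unit_tensor (i, j, k))) (A X - y))"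
    by (subst tlinear_expand[OF A W]) (simp add: inner_sum_left case_prod_unfold)
  also have "\<dots> = (\<Sum>(i, j, k)\<in>tensor_box n1 n2 n. W i j k * tgrad n1 n2 n f X i j k)"
    using tgrad_least_squares[OF A f X] by (intro sum.cong refl) auto
  finally show ?thesis by (simp add: tinner_tensor_box)
qed

lemma tinner_combination_self:
  "tinner n1 n2 n (\<lambda>i j k. a * U i j k + b * V i j k) (\<lambda>i j k. a * U i j k + b * V i j k)
    = a\<^sup>2 * tinner n1 n2 n U U + 2 * a * b * tinner n1 n2 n U V + b\<^sup>2 * tinner n1 n2 n V V"
proof -
  have "(a * u + b * v) * (a * u + b * v) = a\<^sup>2 * (u * u) + 2 * a * b * (u * v) + b\<^sup>2 * (v * v)" for u v :: real
    by (simp add: algebra_simps power2_eq_square)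
  then show ?thesis by (simp only: tinner_def sum.distrib sum_distrib_left)
qed

lemma tinner_diff_scale_right:
  "tinner n1 n2 n W (\<lambda>i j k. U i j k - c * V i j k) = tinner n1 n2 n W U - c * tinner n1 n2 n W V"
  by (simp add: tinner_def right_diff_distrib sum_subtractf sum_distrib_left mult_ac)

section \<open>One iteration\<close>

text \<open>\<open>C12\<close> is the mixed coefficient of a quadratic form on two vectors with
  norms \<open>p\<close>, \<open>q\<close> and inner product \<open>g\<close>. Adding the bounds at
  \<open>(a, b)\<close> and \<open>(a, - b)\<close> cancels \<open>g\<close>.\<close>

lemma polarisation_bound:
  fixes p q c g C11 C12 C22 :: real
  assumes bound: "\<And>a b. \<bar>a\<^sup>2 * C11 + 2 * a * b * C12 + b\<^sup>2 * C22\<bar> \<le> c * (a\<^sup>2 * p\<^sup>2 + 2 * a * b * g + b\<^sup>2 * q\<^sup>2)"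
    and pq: "0 \<le> p" "0 \<le> q"
  shows "C12 \<le> c * p * q"
proof -
  have main: "2 * a * b * C12 \<le> c * (a\<^sup>2 * p\<^sup>2 + b\<^sup>2 * q\<^sup>2)" for a b
    using abs_le_D1[OF bound[of a b]] abs_le_D2[OF bound[of a "- b"]] by (simp add: algebra_simps)
  consider "0 < p" "0 < q" | "p = 0" | "q = 0" using pq by linarith
  then show ?thesis
  proof cases
    case 1
    \<comment> \<open>The weights \<open>a = q\<close>, \<open>b = p\<close> balance the two
      squares.\<close>
    have "(2 * p * q) * C12 \<le> (2 * p * q) * (c * p * q)"
      using main[of q p] by (simp add: algebra_simps power2_eq_square)
    then show ?thesis using 1 by simp
  next
    case 2
    show ?thesis
    proof (rule ccontr)
      assume "\<not> ?thesis"
      then have "0 < C12" using 2 by simp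
      \<comment> \<open>With \<open>p = 0\<close> the right side no longer depends on
        \<open>a\<close>; this \<open>a\<close> makes the left side exceed it by 1.\<close>
      then show False using main[of "(c * q\<^sup>2 + 1) / (2 * C12)" 1] 2 by simp
    qed
  next
    case 3
    show ?thesis
    proof (rule ccontr)
      assume "\<not> ?thesis"
      then have "0 < C12" using 3 by simp
      then show False using main[of 1 "(c * p\<^sup>2 + 1) / (2 * C12)"] 3 by simp
    qed
  qed
qed

text \<open>tRIP controls only norms, so the mixed term is reached by polarisation, which tests
  every combination of \<open>U\<close> and \<open>V\<close>; hence the rank hypothesis ranges over
  all \<open>a\<close> and \<open>b\<close>.\<close>

lemma tRIP_polarised:
  fixes A :: "tensor \<Rightarrow> 'b::real_inner"
  assumes A: "tlinear n1 n2 n A" and rip: "tRIP n1 n2 n A s \<delta>" and \<gamma>: "0 \<le> \<gamma>"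
    and U: "U \<in> tensors n1 n2 n" and V: "V \<in> tensors n1 n2 n"
    and rk: "\<And>a b. tubal_rank n1 n2 n (\<lambda>i j k. a * U i j k + b * V i j k) \<le> s"
  shows "tinner n1 n2 n U V - \<gamma> * inner (A U) (A V)
    \<le> (\<bar>1 - \<gamma>\<bar> + \<gamma> * \<delta>) * tnorm n1 n2 n U * tnorm n1 n2 n V"
proof (rule polarisation_bound)
  fix a b
  let ?W = "\<lambda>i j k. a * U i j k + b * V i j k"
  define N where "N = (tnorm n1 n2 n ?W)\<^sup>2"
  define M where "M = (norm (A ?W))\<^sup>2"
  have "(1 - \<delta>) * N \<le> M" "M \<le> (1 + \<delta>) * N"
    using rip tensors_combination[OF U V] rk unfolding tRIP_def N_def M_def by blast+
  then have "\<bar>N - M\<bar> \<le> \<delta> * N" by (simp add: abs_le_iff algebra_simps)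
  then have "\<gamma> * \<bar>N - M\<bar> \<le> \<gamma> * (\<delta> * N)" using \<gamma> by (intro mult_left_mono)
  \<comment> \<open>The first part is the mismatch of the step size, the second the deviation of
    \<open>A\<close> from an isometry; they produce the two summands of the constant.\<close>
  moreover have "N - \<gamma> * M = (1 - \<gamma>) * N + \<gamma> * (N - M)" by (simp add: algebra_simps)
  moreover have "\<bar>(1 - \<gamma>) * N + \<gamma> * (N - M)\<bar> \<le> \<bar>1 - \<gamma>\<bar> * N + \<gamma> * \<bar>N - M\<bar>"
    using abs_triangle_ineq[of "(1 - \<gamma>) * N" "\<gamma> * (N - M)"] \<gamma> by (simp add: abs_mult N_def)
  ultimately have "\<bar>N - \<gamma> * M\<bar> \<le> (\<bar>1 - \<gamma>\<bar> + \<gamma> * \<delta>) * N" by (simp add: algebra_simps)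
  moreover have N: "N = a\<^sup>2 * (tnorm n1 n2 n U)\<^sup>2 + 2 * a * b * tinner n1 n2 n U V + b\<^sup>2 * (tnorm n1 n2 n V)\<^sup>2"
    by (simp add: N_def tnorm_sq tinner_combination_self)
  moreover have "M = a\<^sup>2 * inner (A U) (A U) + 2 * a * b * inner (A U) (A V) + b\<^sup>2 * inner (A V) (A V)"
    unfolding M_def tlinear_combination[OF A U V] power2_norm_eq_inner
    by (simp add: inner_add_left inner_add_right inner_commute[of "A V" "A U"] power2_eq_square algebra_simps)
  moreover have "N - \<gamma> * M = a\<^sup>2 * ((tnorm n1 n2 n U)\<^sup>2 - \<gamma> * inner (A U) (A U))
      + 2 * a * b * (tinner n1 n2 n U V - \<gamma> * inner (A U) (A V))
      + b\<^sup>2 * ((tnorm n1 n2 n V)\<^sup>2 - \<gamma> * inner (A V) (A V))"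
    unfolding calculation(2,3) by (simp add: algebra_simps)
  ultimately show "\<bar>a\<^sup>2 * ((tnorm n1 n2 n U)\<^sup>2 - \<gamma> * inner (A U) (A U))
      + 2 * a * b * (tinner n1 n2 n U V - \<gamma> * inner (A U) (A V))
      + b\<^sup>2 * ((tnorm n1 n2 n V)\<^sup>2 - \<gamma> * inner (A V) (A V))\<bar>
    \<le> (\<bar>1 - \<gamma>\<bar> + \<gamma> * \<delta>) * (a\<^sup>2 * (tnorm n1 n2 n U)\<^sup>2 + 2 * a * b * tinner n1 n2 n U V + b\<^sup>2 * (tnorm n1 n2 n V)\<^sup>2)"
    by simp
qed (simp_all add: tnorm_def tinner_self_nonneg)

text \<open>The condition on \<open>X\<close> is slice rank at most \<open>r\<close>, which covers
  both the zero start and every thresholded iterate.\<close>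

lemma thresholding_step:
  fixes A :: "tensor \<Rightarrow> 'b::real_inner"
  assumes n: "0 < n" and r: "r \<le> min n1 n2"
    and A: "tlinear n1 n2 n A" and f: "\<And>W. f W = 1 / 2 * (norm (A W - y))\<^sup>2"
    and rip2: "tRIP n1 n2 n A (2 * r) \<delta>2" and rip3: "tRIP n1 n2 n A (3 * r) \<delta>3"
    and Y: "Y \<in> tensors n1 n2 n" and Yr: "slices_orth_rank_le n1 r n Y"
    and y: "y = A Y + e" and e: "norm e \<le> \<epsilon>" and \<gamma>: "0 \<le> \<gamma>"
    and X: "X \<in> tensors n1 n2 n" and Xr: "slices_rank_le r n X"
    and H: "H \<in> tube_hard_thresholds n1 n2 n r (\<lambda>i j k. X i j k - \<gamma> * tgrad n1 n2 n f X i j k)"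
  shows "tnorm n1 n2 n (\<lambda>i j k. H i j k - Y i j k)
    \<le> 2 * (\<bar>1 - \<gamma>\<bar> + \<gamma> * \<delta>3) * tnorm n1 n2 n (\<lambda>i j k. X i j k - Y i j k) + 2 * \<gamma> * \<epsilon> * sqrt (1 + \<delta>2)"
proof -
  let ?in = "tinner n1 n2 n" and ?no = "tnorm n1 n2 n"
  define Z where "Z = (\<lambda>i j k. X i j k - \<gamma> * tgrad n1 n2 n f X i j k)"
  define U where "U = (\<lambda>i j k. H i j k - Y i j k)"
  define V where "V = (\<lambda>i j k. X i j k - Y i j k)"
  have HT: "H \<in> tensors n1 n2 n" "slices_orth_rank_le n1 r n H"
    and best: "?no (\<lambda>i j k. Z i j k - H i j k) \<le> ?no (\<lambda>i j k. Z i j k - Y i j k)"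
    using hard_threshold_properties[OF n r H] Yr unfolding Z_def by auto
  have Hr: "slices_rank_le r n H" and Yr': "slices_rank_le r n Y"
    using slices_rank_le_if_orth HT(2) Yr r by auto
  have UT: "U \<in> tensors n1 n2 n" and VT: "V \<in> tensors n1 n2 n"
    unfolding U_def V_def by (intro tensors_diff HT X Y)+
  have rkU: "tubal_rank n1 n2 n U \<le> 2 * r"
    using slices_rank_le_combination[OF Hr Yr', of 1 "- 1"]
    by (intro tubal_rank_le[OF n UT]) (simp add: U_def mult_2)
  have rkUV: "tubal_rank n1 n2 n (\<lambda>i j k. a * U i j k + b * V i j k) \<le> 3 * r" for a b
  proof (rule tubal_rank_le[OF n tensors_combination[OF UT VT]])
    \<comment> \<open>Both differences contain \<open>Y\<close>; collecting it leaves three tensors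
      of slice rank at most \<open>r\<close> instead of four, hence \<open>3 * r\<close>.\<close>
    have "slices_rank_le (r + r + r) n (\<lambda>i j k. 1 * (a * H i j k + b * X i j k) + (- (a + b)) * Y i j k)"
      by (intro slices_rank_le_combination Hr Xr Yr')
    moreover have "(\<lambda>i j k. 1 * (a * H i j k + b * X i j k) + (- (a + b)) * Y i j k) = (\<lambda>i j k. a * U i j k + b * V i j k)"
      by (simp add: U_def V_def fun_eq_iff algebra_simps)
    moreover have "r + r + r = 3 * r" by simp
    ultimately show "slices_rank_le (3 * r) n (\<lambda>i j k. a * U i j k + b * V i j k)" by simp
  qed
  have AV: "A V = A X - A Y" unfolding V_def by (rule tlinear_diff[OF A X Y])
  define D where "D = (\<lambda>i j k. Z i j k - Y i j k)"
  have "(?no (\<lambda>i j k. Z i j k - H i j k))\<^sup>2 \<le> (?no D)\<^sup>2"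
    using best unfolding D_def by (intro power_mono) (simp_all add: tnorm_def tinner_self_nonneg)
  \<comment> \<open>Expanding the square of \<open>D - U\<close> cancels the square of
    \<open>D\<close>, leaving the squared norm of \<open>U\<close> against twice its inner product
    with \<open>D\<close>.\<close>
  moreover have "(\<lambda>i j k. Z i j k - H i j k) = (\<lambda>i j k. (- 1) * U i j k + 1 * D i j k)"
    by (simp add: D_def U_def fun_eq_iff)
  ultimately have "?in U U \<le> 2 * ?in U D"
    by (simp only: tnorm_sq tinner_combination_self) simp
  also have "?in U D = ?in U V - \<gamma> * ?in U (tgrad n1 n2 n f X)"
  proof -
    have "D = (\<lambda>i j k. V i j k - \<gamma> * tgrad n1 n2 n f X i j k)"
      by (simp add: D_def V_def Z_def fun_eq_iff)
    then show ?thesis by (simp only: tinner_diff_scale_right)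
  qed
  also have "?in U (tgrad n1 n2 n f X) = inner (A U) (A V) - inner (A U) e"
    unfolding tinner_tgrad[OF A f X UT] AV y by (simp add: inner_diff_right inner_add_right)
  finally have "(?no U)\<^sup>2 \<le> 2 * (?in U V - \<gamma> * inner (A U) (A V)) + 2 * \<gamma> * inner (A U) e"
    by (simp add: tnorm_sq algebra_simps)
  also have "\<dots> \<le> 2 * ((\<bar>1 - \<gamma>\<bar> + \<gamma> * \<delta>3) * ?no U * ?no V) + 2 * \<gamma> * (sqrt (1 + \<delta>2) * ?no U * \<epsilon>)"
  proof (intro add_mono mult_left_mono)
    show "?in U V - \<gamma> * inner (A U) (A V) \<le> (\<bar>1 - \<gamma>\<bar> + \<gamma> * \<delta>3) * ?no U * ?no V"
      by (rule tRIP_polarised[OF A rip3 \<gamma> UT VT rkUV])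
    have \<delta>2: "0 < \<delta>2" and "(norm (A U))\<^sup>2 \<le> (1 + \<delta>2) * (?no U)\<^sup>2"
      using rip2 UT rkU unfolding tRIP_def by auto
    then have "norm (A U) \<le> sqrt ((1 + \<delta>2) * (?no U)\<^sup>2)" by (intro real_le_rsqrt)
    then have AU: "norm (A U) \<le> sqrt (1 + \<delta>2) * ?no U"
      by (simp add: real_sqrt_mult tnorm_def tinner_self_nonneg)
    have "inner (A U) e \<le> norm (A U) * norm e" by (rule norm_cauchy_schwarz)
    also have "\<dots> \<le> sqrt (1 + \<delta>2) * ?no U * \<epsilon>"
      using AU e by (intro mult_mono) (use \<delta>2 in \<open>auto simp: tnorm_def tinner_self_nonneg\<close>)
    finally show "inner (A U) e \<le> sqrt (1 + \<delta>2) * ?no U * \<epsilon>" .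
  qed (use \<gamma> in auto)
  finally have q: "?no U * ?no U \<le> ?no U * (2 * (\<bar>1 - \<gamma>\<bar> + \<gamma> * \<delta>3) * ?no V + 2 * \<gamma> * \<epsilon> * sqrt (1 + \<delta>2))"
    by (simp add: algebra_simps power2_eq_square)
  have \<epsilon>: "0 \<le> \<epsilon>" using e norm_ge_zero order_trans by blast
  have \<delta>: "0 < \<delta>2" "0 < \<delta>3" using rip2 rip3 by (auto simp: tRIP_def)
  have no: "0 \<le> ?no W" for W by (simp add: tnorm_def tinner_self_nonneg)
  show ?thesis
  \<comment> \<open>The factor \<open>?no U\<close> is cancelled from \<open>q\<close>; when it is
    zero, only nonnegativity of the right side is at stake.\<close>
  proof (cases "?no U = 0")
    case True
    then show ?thesis using \<epsilon> \<delta> \<gamma> no[of V] by (simp add: U_def V_def)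
  next
    case False
    then have "0 < ?no U" using no[of U] by simp
    then show ?thesis using q by (simp add: U_def V_def)
  qed
qed

section \<open>The error recursion over the iterates\<close>

theorem theorem4p3:
  fixes n1 n2 n3 r :: nat
    and A :: "tensor \<Rightarrow> real ^ 'm"
    and y e :: "real ^ 'm"
    and f :: "tensor \<Rightarrow> real"
    and Xstar :: tensor
    and X Z :: "nat \<Rightarrow> tensor"
    and \<gamma> \<epsilon> \<delta>2r \<delta>3r \<kappa> \<sigma> :: real
    and t :: nat
  assumes "0 < n1" and "0 < n2" and "0 < n3"
    and "r \<le> min n1 n2"
    and f: "\<And>W. f W = 1 / 2 * (norm (A W - y))\<^sup>2"
    and "tlinear n1 n2 n3 A"
    and "tRIP n1 n2 n3 A (2 * r) \<delta>2r"
    and "tRIP n1 n2 n3 A (3 * r) \<delta>3r"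
    and "Xstar \<in> tensors n1 n2 n3"
    and "tubal_rank n1 n2 n3 Xstar \<le> r"
    and "y = A Xstar + e"
    and "norm e \<le> \<epsilon>"
    and "X 0 = (\<lambda>i j k. 0)"
    and "\<And>s. Z (Suc s) = (\<lambda>i j k. X s i j k - \<gamma> * tgrad n1 n2 n3 f (X s) i j k)"
    and "\<And>s. X (Suc s) \<in> tube_hard_thresholds n1 n2 n3 r (Z (Suc s))"
    and "\<kappa> = 2 * (\<bar>1 - \<gamma>\<bar> + \<gamma> * \<delta>3r)"
    and "\<sigma> = 2 * \<gamma> * \<epsilon> * sqrt (1 + \<delta>2r)"
    and "\<kappa> < 1"
  shows "tnorm n1 n2 n3 (\<lambda>i j k. X t i j k - Xstar i j k)
           \<le> \<kappa> ^ t * tnorm n1 n2 n3 (\<lambda>i j k. X 0 i j k - Xstar i j k) + \<sigma> / (1 - \<kappa>)"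
proof -
  note n = \<open>0 < n3\<close> and r = \<open>r \<le> min n1 n2\<close> and rip2 = assms(7) and rip3 = assms(8)
    and Xs = assms(9) and \<kappa> = assms(16) and \<sigma> = assms(17)
  have \<delta>: "0 < \<delta>2r" "0 < \<delta>3r" "\<delta>3r < 1" using rip2 rip3 unfolding tRIP_def by simp_all
  \<comment> \<open>For negative \<open>\<gamma>\<close> the absolute value opens to
    \<open>1 - \<gamma>\<close>, and \<open>\<kappa> = 2 - 2 * \<gamma> * (1 - \<delta>3r)\<close>
    would exceed 2.\<close>
  have \<gamma>: "0 \<le> \<gamma>"
  proof (rule ccontr)
    assume "\<not> 0 \<le> \<gamma>"
    then have "\<gamma> * 1 \<le> \<gamma> * \<delta>3r" using \<delta> by (intro mult_left_mono_neg) auto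
    then have "\<gamma> \<le> \<gamma> * \<delta>3r" by (simp only: mult_1_right)
    moreover have "\<kappa> = 2 - 2 * \<gamma> + 2 * (\<gamma> * \<delta>3r)" using \<kappa> \<open>\<not> 0 \<le> \<gamma>\<close> by simp
    ultimately show False using \<open>\<kappa> < 1\<close> by linarith
  qed
  have \<epsilon>: "0 \<le> \<epsilon>" using \<open>norm e \<le> \<epsilon>\<close> norm_ge_zero order_trans by blast
  have \<kappa>0: "0 \<le> \<kappa>" using \<kappa> \<gamma> \<delta> by simp
  have \<sigma>0: "0 \<le> \<sigma>" using \<sigma> \<gamma> \<epsilon> \<delta> by simp
  have Xr: "slices_orth_rank_le n1 r n3 Xstar"
    using slices_orth_rank_le_if_tubal_rank[OF n Xs] assms(10) by blast
  have iter: "X s \<in> tensors n1 n2 n3 \<and> slices_rank_le r n3 (X s)" for s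
  proof (cases s)
    case 0
    have "slice n3 (X 0) k = mmul r (\<lambda>i p. 0) (\<lambda>p j. 0)" for k
      by (simp add: assms(13) fun_eq_iff slice_eq mmul_def)
    then show ?thesis using 0 assms(13) unfolding slices_rank_le_def by (auto simp: tensors_def)
  next
    case (Suc u)
    then show ?thesis
      using hard_threshold_properties(1,2)[OF n r assms(15)[of u]] slices_rank_le_if_orth r by auto
  qed
  have step: "tnorm n1 n2 n3 (\<lambda>i j k. X (Suc s) i j k - Xstar i j k)
      \<le> \<kappa> * tnorm n1 n2 n3 (\<lambda>i j k. X s i j k - Xstar i j k) + \<sigma>" for s
    unfolding \<kappa> \<sigma>
    using iter[of s] assms(15)[of s, unfolded assms(14)]
    by (intro thresholding_step[OF n r assms(6) f rip2 rip3 Xs Xr assms(11,12) \<gamma>]) auto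
  \<comment> \<open>\<open>\<sigma> / (1 - \<kappa>)\<close> is the fixed point of one step of the
    recursion, so the induction carries it along unchanged.\<close>
  have \<sigma>_fix: "\<kappa> * (\<sigma> / (1 - \<kappa>)) + \<sigma> = \<sigma> / (1 - \<kappa>)"
    using \<open>\<kappa> < 1\<close> by (simp add: field_simps)
  show ?thesis
  proof (induction t)
    case 0
    then show ?case using \<sigma>0 \<open>\<kappa> < 1\<close> by simp
  next
    case (Suc t)
    have "tnorm n1 n2 n3 (\<lambda>i j k. X (Suc t) i j k - Xstar i j k)
        \<le> \<kappa> * (\<kappa> ^ t * tnorm n1 n2 n3 (\<lambda>i j k. X 0 i j k - Xstar i j k) + \<sigma> / (1 - \<kappa>)) + \<sigma>"
      using step[of t] mult_left_mono[OF Suc \<kappa>0] by linarith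
    also have "\<kappa> * (\<kappa> ^ t * tnorm n1 n2 n3 (\<lambda>i j k. X 0 i j k - Xstar i j k) + \<sigma> / (1 - \<kappa>)) + \<sigma>
        = \<kappa> ^ Suc t * tnorm n1 n2 n3 (\<lambda>i j k. X 0 i j k - Xstar i j k) + \<sigma> / (1 - \<kappa>)"
      using \<sigma>_fix by (simp add: distrib_left)
    finally show ?case .
  qed
qed

end
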